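(* Let $n$ be a positive integer. The bijection $A\mapsto (w,\mathcal{I})$ from Shi alcoves to labeled Dyck paths (of size $n$) sends the pair of statistics $\left(\binom{n}{2}-\mathrm{shi},\ \mathrm{ish}\right)$ to the pair $(\mathrm{area}',\ \mathrm{bounce})$. That is, for every Shi alcove $A$ with corresponding labeled Dyck path $(w,\mathcal{I})$, $$\binom{n}{2}-\mathrm{shi}(A)=\mathrm{area}'(w,\mathcal{I})\qquad\text{and}\qquad \mathrm{ish}(A)=\mathrm{bounce}(w,\mathcal{I}).$$
   Context: **Arrangements.** Work in $\mathbb{R}^n_0=\mathbb{R}^n/\mathbb{R}(1,\dots,1)$, with $x_1,\dots,x_n$ the standard coordinates on $\mathbb{R}^n$ (only differences $x_i-x_j$ are used). The Shi arrangement is $\mathrm{Shi}(n)=\{x_i-x_j=a: 1\le i<j\le n,\ a\in\{0,1\}\}$, and the affine arrangement is $\mathrm{Aff}(n)=\{x_i-x_j=a:1\le i<j\le n,\ a\in\mathbb{Z}\}$. Chambers are connected components of the complement of the union of the hyperplanes; chambers of $\mathrm{Aff}(n)$ are called alcoves. The dominant cone is $C_\circ=\{x_1>x_2>\cdots>x_n\}$ and the fundamental alcove is $A_\circ=\{x_1>x_2>\cdots>x_n>x_1-1\}$. The length of an alcove is the number of hyperplanes of $\mathrm{Aff}(n)$ separating it from $A_\circ$. Each chamber of $\mathrm{Shi}(n)$ contains a unique alcove of minimum length (a known fact), called its representing alcove; the representing alcoves of the chambers of $\mathrm{Shi}(n)$ are called Shi alcoves. **Symmetric group.** $\mathfrak{S}(n)$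 acts on $\mathbb{R}^n_0$ by permuting coordinates with $w e_i=e_{w(i)}$ for the standard basis $e_1,\dots,e_n$, so that $wC_\circ=\{x_{w(1)}>x_{w(2)}>\cdots>x_{w(n)}\}$. For each alcove $A$ there is a unique $w\in\mathfrak{S}(n)$ with $A\subseteq wC_\circ$; then $w^{-1}A$ is an alcove contained in $C_\circ$. A pair $(i,j)$ with $1\le i<j\le n$ is an inversion of $w$ if $w(i)>w(j)$ and a non-inversion of $w$ if $w(i)<w(j)$. **Statistics on Shi alcoves.** For a Shi alcove $A\subseteq wC_\circ$: - $\mathrm{shi}(A)$ is the number of hyperplanes of $\mathrm{Shi}(n)$ separating $A$ from $A_\circ$; - $\mathrm{ish}(A)$ is the number of hyperplanes of the form $x_i-x_n=a$ (with $1\le i\le n-1$, $a\in\mathbb{Z}$) separating $w^{-1}A$ from $A_\circ$. **Root poset, ideals, Dyck paths.** Let $\Phi^+=\{e_i-e_j:1\le i<j\le n\}$, partially ordered by $e_j-e_k\le e_i-e_\ell$ if and only if $i\le j<k\le \ell$. An ideal is a subset $\mathcal{I}\subseteq\Phi^+$ such that $\alpha\in\mathcal{I}$ and $\alpha\le\beta$ imply $\beta\in\mathcal{I}$. Identify $e_i-e_j$ with the unit square in the plane whose top right corner is $(i,j)$. The lower boundary of the collection of squares of $\mathcal{I}$ gives a lattice path from $(0,0)$ to $(n,n)$ with steps $(0,1)$ and $(1,0)$ staying weakly above the diagonal (a Dyck path); explicitly, for each $j\in\{1,\dots,n\}$ its vertical step from height $j-1$ to height $j$ has abscissa $\#\{i<j: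 e_i-e_j\in\mathcal{I}\}$. This is a bijection between ideals and Dyck paths. The squares of $\mathcal{I}$ are those above the path; the roots not in $\mathcal{I}$ are the squares between the path and the diagonal ("below" the path). **Labeled Dyck paths.** A labeled Dyck path is a pair $(w,\mathcal{I})$ with $w\in\mathfrak{S}(n)$ and $\mathcal{I}\subseteq\Phi^+$ an ideal such that for every minimal element $e_i-e_j$ of $\mathcal{I}$, the pair $(i,j)$ is a non-inversion of $w$. **The bijection.** A Shi alcove $A$ is sent to $(w,\mathcal{I})$, where $w\in\mathfrak{S}(n)$ is the permutation with $A\subseteq wC_\circ$ and $$\mathcal{I}=\{e_i-e_j\in\Phi^+ : x_i-x_j>1 \text{ on } w^{-1}A\}.$$ By a result of Pak and Stanley this is a bijection from Shi alcoves to labeled Dyck paths. **Statistics on labeled Dyck paths.** - $\mathrm{area}'(w,\mathcal{I})$ is the number of non-inversions $(i,j)$ of $w$ ($1\le i<j\le n$) with $e_i-e_j\notin\mathcal{I}$. - $\mathrm{bounce}(w,\mathcal{I})=\mathrm{bounce}(\mathcal{I})$ is defined as follows. The bounce path of $\mathcal{I}$ starts at $(n,n)$, travels left until it hits the Dyck path of $\mathcal{I}$ at the top of a vertical step, then travels down until it hits the diagonal, and repeats these two steps until it reaches $(0,0)$. (So from a diagonal point $(m,m)$ with $m\geq 1$ the next diagonal point is $(a,a)$ with $a=\#\{i<m:e_i-e_m\in\mathcal{I}\}$.) Then $\mathrm{bounce}(\mathcal{I})$ is the sum of all $i\in\{1,\dots,n-1\}$ such that the bounce path contains the diagonal point $(i,i)$.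 *)

theory Defs
  imports "HOL-Analysis.Analysis" "HOL-Combinatorics.Permutations"
begin

text \<open>
  Vectors of $R^n$ are functions \<open>nat \<Rightarrow> real\<close> with coordinates indexed by \<open>{1..n}\<close> and value
  \<open>0\<close> elsewhere. On these vectors the topology of pointwise convergence is the Euclidean one.

  The quotient of $R^n$ by the line spanned by $(1,\dots,1)$ is represented by the vectors with
  coordinate sum \<open>0\<close>, which form an $S_n$-invariant linear complement of that line. Lemma
  \<open>quot_space_unique_representative\<close> below states that every class has exactly one such
  representative; coordinate differences do not depend on the choice of representative.
\<close>

definition quot_space :: "nat \<Rightarrow> (nat \<Rightarrow> real) set" where
  "quot_space n = {x. (\<forall>i. i \<notin> {1..n} \<longrightarrow> x i = 0) \<and> (\<Sum>i=1..n. x i) = 0}"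

lemma quot_space_unique_representative:
  fixes x :: "nat \<Rightarrow> real"
  assumes "n \<ge> 1" and "\<And>i. i \<notin> {1..n} \<Longrightarrow> x i = 0"
  shows "\<exists>!y. y \<in> quot_space n \<and> (\<exists>c. \<forall>i\<in>{1..n}. x i - y i = c)"
proof -
  define c where "c = (\<Sum>i=1..n. x i) / real n"
  define y where "y = (\<lambda>i. if i \<in> {1..n} then x i - c else 0)"
  have "(\<Sum>i=1..n. y i) = (\<Sum>i=1..n. x i - c)"
    unfolding y_def by (rule sum.cong) auto
  also have "\<dots> = 0"
    using assms(1) by (simp add: sum_subtractf c_def)
  finally have y: "y \<in> quot_space n"
    by (simp add: quot_space_def y_def)
  show ?thesis
  proof (rule ex1I[of _ y])
    show "y \<in> quot_space n \<and> (\<exists>c. \<forall>i\<in>{1..n}. x i - y i = c)"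
    proof
      show "\<exists>c. \<forall>i\<in>{1..n}. x i - y i = c"
        by (rule exI[of _ c]) (simp add: y_def)
    qed (fact y)
  next
    fix z assume "z \<in> quot_space n \<and> (\<exists>c. \<forall>i\<in>{1..n}. x i - z i = c)"
    then obtain d where z: "z \<in> quot_space n" and "\<forall>i\<in>{1..n}. x i - z i = d"
      by blast
    then have d: "z i = x i - d" if "i \<in> {1..n}" for i
      using that by force
    have "0 = (\<Sum>i=1..n. z i)"
      using z by (simp add: quot_space_def)
    also have "\<dots> = (\<Sum>i=1..n. x i - d)"
      by (rule sum.cong) (use d in auto)
    finally have "d = c"
      using assms(1) by (simp add: sum_subtractf c_def)
    moreover have "z i = 0" if "i \<notin> {1..n}" for i
      using z that by (simp add: quot_space_def)
    ultimately show "z = y"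
      using d by (simp add: y_def fun_eq_iff)
  qed
qed


subsection \<open>Arrangements, chambers and alcoves\<close>

definition hyperplane :: "nat \<Rightarrow> nat \<Rightarrow> nat \<Rightarrow> int \<Rightarrow> (nat \<Rightarrow> real) set" where
  "hyperplane n i j a = {x \<in> quot_space n. x i - x j = of_int a}"

definition Shi :: "nat \<Rightarrow> (nat \<Rightarrow> real) set set" where
  "Shi n = {hyperplane n i j a | i j a. 1 \<le> i \<and> i < j \<and> j \<le> n \<and> a \<in> {0, 1}}"

definition Aff :: "nat \<Rightarrow> (nat \<Rightarrow> real) set set" where
  "Aff n = {hyperplane n i j a | i j a. 1 \<le> i \<and> i < j \<and> j \<le> n}"

definition chambers :: "nat \<Rightarrow> (nat \<Rightarrow> real) set set \<Rightarrow> (nat \<Rightarrow> real) set set" where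
  "chambers n \<H> = components (quot_space n - \<Union>\<H>)"

abbreviation alcoves :: "nat \<Rightarrow> (nat \<Rightarrow> real) set set" where
  "alcoves n \<equiv> chambers n (Aff n)"

definition dominant_cone :: "nat \<Rightarrow> (nat \<Rightarrow> real) set" where
  "dominant_cone n = {x \<in> quot_space n. \<forall>i. 1 \<le> i \<and> i < n \<longrightarrow> x i > x (i + 1)}"

definition fundamental_alcove :: "nat \<Rightarrow> (nat \<Rightarrow> real) set" where
  "fundamental_alcove n = {x \<in> dominant_cone n. x n > x 1 - 1}"

text \<open>
  A hyperplane separates two sets if they lie on different sides of it, the sides being the
  connected components of its complement.
\<close>

definition separates ::
    "nat \<Rightarrow> (nat \<Rightarrow> real) set \<Rightarrow> (nat \<Rightarrow> real) set \<Rightarrow> (nat \<Rightarrow> real) set \<Rightarrow> bool" where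
  "separates n H A B \<longleftrightarrow>
    (\<exists>P\<in>components (quot_space n - H). \<exists>Q\<in>components (quot_space n - H).
       P \<noteq> Q \<and> A \<subseteq> P \<and> B \<subseteq> Q)"

definition alcove_length :: "nat \<Rightarrow> (nat \<Rightarrow> real) set \<Rightarrow> nat" where
  "alcove_length n A = card {H \<in> Aff n. separates n H A (fundamental_alcove n)}"

definition shi_alcoves :: "nat \<Rightarrow> (nat \<Rightarrow> real) set set" where
  "shi_alcoves n =
    {A. \<exists>R\<in>chambers n (Shi n). is_arg_min (alcove_length n) (\<lambda>B. B \<in> alcoves n \<and> B \<subseteq> R) A}"


subsection \<open>The symmetric group and the statistics on Shi alcoves\<close>

text \<open>
  Since $w e_i = e_{w(i)}$, the coordinate of $w x$ at position $w(i)$ is $x_i$.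
\<close>

definition perm_act :: "(nat \<Rightarrow> nat) \<Rightarrow> (nat \<Rightarrow> real) \<Rightarrow> (nat \<Rightarrow> real)" where
  "perm_act w x = (\<lambda>i. x (inv w i))"

definition alcove_perm :: "nat \<Rightarrow> (nat \<Rightarrow> real) set \<Rightarrow> (nat \<Rightarrow> nat)" where
  "alcove_perm n A = (THE w. w permutes {1..n} \<and> A \<subseteq> perm_act w ` dominant_cone n)"

definition dominant_translate :: "nat \<Rightarrow> (nat \<Rightarrow> real) set \<Rightarrow> (nat \<Rightarrow> real) set" where
  "dominant_translate n A = perm_act (inv (alcove_perm n A)) ` A"

definition shi :: "nat \<Rightarrow> (nat \<Rightarrow> real) set \<Rightarrow> nat" where
  "shi n A = card {H \<in> Shi n. separates n H A (fundamental_alcove n)}"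

definition ish :: "nat \<Rightarrow> (nat \<Rightarrow> real) set \<Rightarrow> nat" where
  "ish n A =
    card {H \<in> {hyperplane n i n a | i a. 1 \<le> i \<and> i \<le> n - 1}.
            separates n H (dominant_translate n A) (fundamental_alcove n)}"


subsection \<open>Labeled Dyck paths\<close>

text \<open>The root $e_i - e_j$ is encoded as the pair \<open>(i, j)\<close>.\<close>

definition pos_roots :: "nat \<Rightarrow> (nat \<times> nat) set" where
  "pos_roots n = {(i, j). 1 \<le> i \<and> i < j \<and> j \<le> n}"

definition root_le :: "nat \<times> nat \<Rightarrow> nat \<times> nat \<Rightarrow> bool" where
  "root_le \<alpha> \<beta> \<longleftrightarrow> fst \<beta> \<le> fst \<alpha> \<and> snd \<alpha> \<le> snd \<beta>"

definition root_ideal :: "nat \<Rightarrow> (nat \<times> nat) set \<Rightarrow> bool" where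
  "root_ideal n I \<longleftrightarrow>
    I \<subseteq> pos_roots n \<and> (\<forall>\<alpha>\<in>I. \<forall>\<beta>\<in>pos_roots n. root_le \<alpha> \<beta> \<longrightarrow> \<beta> \<in> I)"

definition minimal_roots :: "(nat \<times> nat) set \<Rightarrow> (nat \<times> nat) set" where
  "minimal_roots I = {\<alpha> \<in> I. \<forall>\<beta>\<in>I. root_le \<beta> \<alpha> \<longrightarrow> \<beta> = \<alpha>}"

definition non_inversions :: "nat \<Rightarrow> (nat \<Rightarrow> nat) \<Rightarrow> (nat \<times> nat) set" where
  "non_inversions n w = {(i, j). 1 \<le> i \<and> i < j \<and> j \<le> n \<and> w i < w j}"

definition labeled_dyck_paths :: "nat \<Rightarrow> ((nat \<Rightarrow> nat) \<times> (nat \<times> nat) set) set" where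
  "labeled_dyck_paths n =
    {(w, I). w permutes {1..n} \<and> root_ideal n I \<and> minimal_roots I \<subseteq> non_inversions n w}"

definition alcove_ideal :: "nat \<Rightarrow> (nat \<Rightarrow> real) set \<Rightarrow> (nat \<times> nat) set" where
  "alcove_ideal n A = {(i, j) \<in> pos_roots n. \<forall>x\<in>dominant_translate n A. x i - x j > 1}"

definition alcove_to_path :: "nat \<Rightarrow> (nat \<Rightarrow> real) set \<Rightarrow> (nat \<Rightarrow> nat) \<times> (nat \<times> nat) set" where
  "alcove_to_path n A = (alcove_perm n A, alcove_ideal n A)"

definition area' :: "nat \<Rightarrow> (nat \<Rightarrow> nat) \<Rightarrow> (nat \<times> nat) set \<Rightarrow> nat" where
  "area' n w I = card (non_inversions n w - I)"

text \<open>
  The Dyck path of \<open>I\<close> is given by the abscissae of its vertical steps; the step in question goes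
  from height \<open>j - 1\<close> to height \<open>j\<close>.
\<close>

definition vertical_step :: "(nat \<times> nat) set \<Rightarrow> nat \<Rightarrow> nat" where
  "vertical_step I j = card {i. i < j \<and> (i, j) \<in> I}"

text \<open>
  \<open>m \<in> bounce_points n I\<close> means that the bounce path contains the diagonal point \<open>(m, m)\<close>: going
  left from \<open>(m, m)\<close>, it meets the top of the vertical step of height \<open>m - 1\<close> to \<open>m\<close>, whose
  abscissa is then the diagonal point reached by going down.
\<close>

inductive_set bounce_points :: "nat \<Rightarrow> (nat \<times> nat) set \<Rightarrow> nat set"
  for n :: nat and I :: "(nat \<times> nat) set" where
  start: "n \<in> bounce_points n I"
| bounce: "m \<in> bounce_points n I \<Longrightarrow> m \<ge> 1 \<Longrightarrow> vertical_step I m \<in> bounce_points n I"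

definition bounce :: "nat \<Rightarrow> (nat \<times> nat) set \<Rightarrow> nat" where
  "bounce n I = \<Sum>{i \<in> {1..n - 1}. i \<in> bounce_points n I}"

end

theory Submission
  imports Defs
begin

text \<open>
  Two generic points lie in the same alcove iff all coordinate differences have the same floors
  (\<open>alcoves_eq\<close>), and in the same Shi chamber iff the differences $x_i - x_j$ with $i < j$ compare in
  the same way with 0 and with 1 (\<open>Shi_chamber_of_generic\<close>). Let \<open>w\<close> sort the coordinates of a
  generic point \<open>x\<close> decreasingly and write $y_i = x_{w(i)}$, so that all $y_i - y_j$ with $i < j$ are
  positive. Counting separating hyperplanes shows that the length of the alcove of \<open>x\<close> is the sum
  of the floors $\lfloor y_i - y_j\rfloor$ plus the number of inversions of \<open>w\<close>
  (\<open>alcove_length_sorted\<close>). A Shi chamber fixes \<open>w\<close> and, for each non-inversion $(i,j)$, whether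
  $y_i - y_j > 1$; at an inversion it says nothing about 1.

  The problem is therefore to minimise floors. Let \<open>I\<close> be the ideal generated by the non-inversions
  with $y_i - y_j > 1$. The number of bounces that the bounce path makes on its way from \<open>j\<close> down to
  \<open>i\<close> is a lower bound for $\lfloor y_i - y_j\rfloor$, because each bounce follows a root of \<open>I\<close>
  (\<open>bounce_count_lower_bound\<close>). These bounce counts \<open>k\<close> satisfy
  $k_{ij} + k_{jl} \le k_{il} \le k_{ij} + k_{jl} + 1$, and such integers are the floors of an actual
  point (\<open>ex_point_with_floors\<close>). So all lower bounds are attained simultaneously, by exactly one
  alcove, which is the shortest of its Shi chamber (\<open>path_point_alcove_shortest\<close>). Hence the Shi
  alcoves are exactly the alcoves built in this way from labelled Dyck paths (\<open>shi_alcoves_iff\<close>), and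
  since $k_{ij} \ge 1$ iff $(i,j) \in I$, the path can be read off from the alcove; this is the
  bijection.

  The statistics can now be compared on these points. A positive root contributes to \<open>shi\<close> iff it is
  an inversion or belongs to \<open>I\<close>, so its complement is counted by \<open>area'\<close> (\<open>shi_plus_area'\<close>). The
  statistic \<open>ish\<close> is the sum of the bounce counts $k_{in}$ over $i < n$; a point $(p,p)$ of the bounce
  path with $p < n$ is counted there once for each $i \le p$, that is \<open>p\<close> times, which is its
  contribution to \<open>bounce\<close> (\<open>sum_bounce_count\<close>).
\<close>

section \<open>Regions of the complement of a set of hyperplanes\<close>

text \<open>
  Subtracting the mean changes no difference, so points can be specified by arbitrary real
  coordinates as long as only differences matter.
\<close>

lemma ex_quot_space_differences:
  fixes f :: "nat \<Rightarrow> real"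
  assumes "n \<ge> 1"
  shows "\<exists>y\<in>quot_space n. \<forall>i\<in>{1..n}. \<forall>j\<in>{1..n}. y i - y j = f i - f j"
proof -
  define g where "g = (\<lambda>i. if i \<in> {1..n} then f i else 0)"
  have "\<And>i. i \<notin> {1..n} \<Longrightarrow> g i = 0" by (auto simp: g_def)
  then obtain y c where y: "y \<in> quot_space n" "\<forall>i\<in>{1..n}. g i - y i = c"
    using quot_space_unique_representative[OF assms, of g] by blast
  have "y i - y j = f i - f j" if "i \<in> {1..n}" "j \<in> {1..n}" for i j
  proof -
    have "g i - y i = c" "g j - y j = c" using y(2) that by blast+
    then show ?thesis using that unfolding g_def by simp
  qed
  then show ?thesis using y(1) by blast
qed

text \<open>
  Statistics are defined by counting hyperplanes as sets, whereas the arguments count triples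
  $(i,j,a)$. A hyperplane determines its triple: moving a point of it along a coordinate other
  than $i$ and $j$ stays in the hyperplane, so $\{k,l\}$ must be contained in $\{i,j\}$.
\<close>

lemma inj_on_hyperplane:
  "inj_on (\<lambda>(i, j, a). hyperplane n i j a) {(i, j, a). (i, j) \<in> pos_roots n}"
proof (rule inj_onI)
  fix p q :: "nat \<times> nat \<times> int"
  obtain i j a k l b where p: "p = (i, j, a)" and q: "q = (k, l, b)"
    using prod_cases3 by metis
  assume "p \<in> {(i, j, a). (i, j) \<in> pos_roots n}" "q \<in> {(i, j, a). (i, j) \<in> pos_roots n}"
    "(case p of (i, j, a) \<Rightarrow> hyperplane n i j a) = (case q of (i, j, a) \<Rightarrow> hyperplane n i j a)"
  then have r: "(i, j) \<in> pos_roots n" "(k, l) \<in> pos_roots n"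
    and eq: "hyperplane n i j a = hyperplane n k l b"
    by (simp_all add: p q)
  have "n \<ge> 1" using r(1) by (auto simp: pos_roots_def)
  have iff: "f i - f j = of_int a \<longleftrightarrow> f k - f l = of_int b" for f :: "nat \<Rightarrow> real"
  proof -
    obtain y where y: "y \<in> quot_space n"
      "\<forall>i\<in>{1..n}. \<forall>j\<in>{1..n}. y i - y j = f i - f j"
      using ex_quot_space_differences[OF \<open>n \<ge> 1\<close>] by blast
    then have "y i - y j = f i - f j" "y k - y l = f k - f l"
      using r by (auto simp: pos_roots_def)
    moreover have "y i - y j = of_int a \<longleftrightarrow> y k - y l = of_int b"
      using eq y(1) unfolding hyperplane_def by blast
    ultimately show ?thesis by simp
  qed
  define f where "f = (\<lambda>q. if q = i then real_of_int a else 0)"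
  have f: "f i - f j = of_int a"
    using r by (auto simp: f_def pos_roots_def)
  have kl: "{k, l} \<subseteq> {i, j}"
  proof (rule ccontr)
    assume "\<not> ?thesis"
    then obtain m where m: "m \<in> {k, l}" "m \<noteq> i" "m \<noteq> j" by blast
    \<comment> \<open>Raising coordinate \<open>m\<close> changes the second difference but not the first.\<close>
    have "(f(m := f m + 1)) i - (f(m := f m + 1)) j = of_int a"
      using f m by simp
    then have "(f(m := f m + 1)) k - (f(m := f m + 1)) l = f k - f l"
      using iff f by metis
    then show False
      using m(1) r(2) by (auto simp: pos_roots_def split: if_splits)
  qed
  then have "k = i" "l = j" using r by (auto simp: pos_roots_def)
  moreover have "a = b" using iff[of f] f calculation by simp
  ultimately show "p = q" by (simp add: p q)
qed

text \<open>
  Two points lie in the same region exactly if no hyperplane has them on different sides. A path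
  that changes sides hits the hyperplane by the intermediate value theorem; conversely the
  straight segment between points on the same sides avoids all hyperplanes. The result is applied
  to the Shi arrangement, to the affine one, and to a single hyperplane.
\<close>

lemma connected_component_complement_hyperplanes:
  fixes n :: nat and P :: "(nat \<times> nat \<times> int) set"
  defines "S \<equiv> quot_space n - (\<Union>(i, j, a)\<in>P. hyperplane n i j a)"
  shows "connected_component S x y \<longleftrightarrow> x \<in> S \<and> y \<in> S \<and>
    (\<forall>(i, j, a)\<in>P. x i - x j < of_int a \<longleftrightarrow> y i - y j < of_int a)"
    (is "_ \<longleftrightarrow> ?R")
proof
  assume "connected_component S x y"
  then obtain T where T: "connected T" "T \<subseteq> S" "x \<in> T" "y \<in> T"
    unfolding connected_component_def by blast
  have cross: False
    if "(i, j, a) \<in> P" "u \<in> T" "v \<in> T" "u i - u j < of_int a" "\<not> v i - v j < of_int a"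
    for i j a u v
  proof -
    have "continuous_on T (\<lambda>z. z i - z j)"
      by (intro continuous_on_diff continuous_on_subset[OF continuous_on_product_coordinates])
         auto
    then have "connected ((\<lambda>z. z i - z j) ` T)"
      using T(1) by (rule connected_continuous_image)
    then have "of_int a \<in> (\<lambda>z. z i - z j) ` T"
      by (rule connectedD_interval[of _ "u i - u j" "v i - v j"]) (use that in auto)
    then obtain z where "z \<in> T" "z i - z j = of_int a" by force
    then show False using T(2) that(1) unfolding S_def hyperplane_def by blast
  qed
  show ?R
  proof (intro conjI ballI)
    show "x \<in> S" "y \<in> S" using T by auto
    fix p assume "p \<in> P"
    moreover obtain i j a where p: "p = (i, j, a)" by (cases p)
    ultimately show "case p of (i, j, a) \<Rightarrow> x i - x j < of_int a \<longleftrightarrow> y i - y j < of_int a"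
      using cross[of i j a x y] cross[of i j a y x] T(3,4) unfolding p by auto
  qed
next
  assume R: ?R
  define p where "p = (\<lambda>t i. (1 - t) * x i + t * y i)"
  have xy: "x \<in> quot_space n" "y \<in> quot_space n" using R by (auto simp: S_def)
  have off: "x i - x j \<noteq> of_int a \<and> y i - y j \<noteq> of_int a" if "(i, j, a) \<in> P" for i j a
    using R that unfolding S_def hyperplane_def by fastforce
  have diff: "p t i - p t j = (1 - t) * (x i - x j) + t * (y i - y j)" for t i j
    by (simp add: p_def algebra_simps)
  have quot: "p t \<in> quot_space n" for t
    using xy by (simp add: quot_space_def p_def sum.distrib flip: sum_distrib_left)
  have "p t \<in> S" if t: "t \<in> {0..1}" for t
  proof -
    have "p t i - p t j \<noteq> of_int a" if P: "(i, j, a) \<in> P" for i j a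
    proof (cases "x i - x j < of_int a")
      case True
      then have "y i - y j < of_int a" using R P by fast
      with True t have "(1 - t) * (x i - x j) + t * (y i - y j) < of_int a"
        by (intro convex_bound_lt) auto
      then show ?thesis by (simp add: diff)
    next
      case False
      then have "- (x i - x j) < - of_int a" "- (y i - y j) < - of_int a"
        using R P off[OF P] by fastforce+
      with t have "(1 - t) * - (x i - x j) + t * - (y i - y j) < - of_int a"
        by (intro convex_bound_lt) auto
      then have "(1 - t) * (x i - x j) + t * (y i - y j) > of_int a"
        by (simp add: algebra_simps)
      then show ?thesis by (simp add: diff)
    qed
    then show ?thesis using quot by (auto simp: S_def hyperplane_def)
  qed
  moreover have "connected (p ` {0..1})"
    by (intro connected_continuous_image continuous_on_coordinatewise_then_product)
       (auto simp: p_def intro!: continuous_intros)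
  moreover have "p 0 = x" "p 1 = y" by (auto simp: p_def)
  ultimately show "connected_component S x y"
    unfolding connected_component_def by (intro exI[of _ "p ` {0..1}"]) (auto intro: rev_image_eqI[of 0] rev_image_eqI[of 1])
qed

lemma mem_components_complement_hyperplanes:
  fixes n :: nat and P :: "(nat \<times> nat \<times> int) set"
  defines "S \<equiv> quot_space n - (\<Union>(i, j, a)\<in>P. hyperplane n i j a)"
  shows "C \<in> components S \<longleftrightarrow> (\<exists>x\<in>S. C = {y \<in> S.
    \<forall>(i, j, a)\<in>P. x i - x j < of_int a \<longleftrightarrow> y i - y j < of_int a})"
proof -
  have "connected_component S x y \<longleftrightarrow>
      y \<in> S \<and> (\<forall>(i, j, a)\<in>P. x i - x j < of_int a \<longleftrightarrow> y i - y j < of_int a)"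
    if "x \<in> S" for x y
    using that unfolding S_def connected_component_complement_hyperplanes
    by (simp only: simp_thms)
  then have "connected_component_set S x = {y \<in> S.
      \<forall>(i, j, a)\<in>P. x i - x j < of_int a \<longleftrightarrow> y i - y j < of_int a}" if "x \<in> S" for x
    using that by (intro Collect_cong)
  then show ?thesis
    unfolding components_def image_iff by (intro bex_cong refl) (simp only:)
qed

lemma separates_iff:
  assumes "A \<noteq> {}" "B \<noteq> {}" "A \<subseteq> quot_space n" "B \<subseteq> quot_space n"
  shows "separates n (hyperplane n i j a) A B \<longleftrightarrow>
    (\<forall>x\<in>A. x i - x j < of_int a) \<and> (\<forall>y\<in>B. y i - y j > of_int a) \<or>
    (\<forall>x\<in>A. x i - x j > of_int a) \<and> (\<forall>y\<in>B. y i - y j < of_int a)" (is "_ \<longleftrightarrow> ?R")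
proof -
  define S where "S = quot_space n - hyperplane n i j a"
  define side where "side = (\<lambda>x :: nat \<Rightarrow> real. {y \<in> S. x i - x j < of_int a \<longleftrightarrow> y i - y j < (of_int a :: real)})"
  have S: "x \<in> S \<longleftrightarrow> x \<in> quot_space n \<and> x i - x j \<noteq> of_int a" for x
    by (auto simp: S_def hyperplane_def)
  have comp: "C \<in> components S \<longleftrightarrow> (\<exists>x\<in>S. C = side x)" for C
    using mem_components_complement_hyperplanes[of C n "{(i, j, a)}"]
    by (simp add: S_def side_def)
  then have "components S = side ` S" by blast
  then have sep: "separates n (hyperplane n i j a) A B \<longleftrightarrow>
    (\<exists>x\<in>S. \<exists>y\<in>S. side x \<noteq> side y \<and> A \<subseteq> side x \<and> B \<subseteq> side y)"
    unfolding separates_def S_def[symmetric] by (simp add: conj_assoc)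
  show ?thesis
  proof
    assume "separates n (hyperplane n i j a) A B"
    then obtain x y where xy: "x \<in> S" "y \<in> S" "side x \<noteq> side y" "A \<subseteq> side x" "B \<subseteq> side y"
      unfolding sep by blast
    have ne: "\<not> (x i - x j < of_int a \<longleftrightarrow> y i - y j < of_int a)"
      using xy(3) unfolding side_def by blast
    have A: "(z i - z j < of_int a \<longleftrightarrow> x i - x j < of_int a) \<and> z i - z j \<noteq> of_int a" if "z \<in> A" for z
      using xy(4) that by (auto simp: side_def S)
    have B: "(z i - z j < of_int a \<longleftrightarrow> y i - y j < of_int a) \<and> z i - z j \<noteq> of_int a" if "z \<in> B" for z
      using xy(5) that by (auto simp: side_def S)
    show ?R
    proof (cases "x i - x j < of_int a")
      case True
      then have "\<forall>z\<in>A. z i - z j < of_int a" using A by blast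
      moreover have "\<forall>z\<in>B. z i - z j > of_int a" using B ne True by force
      ultimately show ?thesis by blast
    next
      case False
      then have "\<forall>z\<in>A. z i - z j > of_int a" using A by force
      moreover have "\<forall>z\<in>B. z i - z j < of_int a" using B ne False by blast
      ultimately show ?thesis by blast
    qed
  next
    assume R: ?R
    obtain x y where xy: "x \<in> A" "y \<in> B" using assms by blast
    have "x \<in> S" "y \<in> S" using R xy assms by (force simp: S)+
    moreover have "x \<notin> side y" using R xy by (auto simp: side_def)
    moreover have "x \<in> side x" using \<open>x \<in> S\<close> by (simp add: side_def)
    moreover have "A \<subseteq> side x" "B \<subseteq> side y"
      using R xy assms by (force simp: side_def S)+
    ultimately show "separates n (hyperplane n i j a) A B" unfolding sep by blast
  qed
qed

section \<open>Alcoves and Shi regions through floors of coordinate differences\<close>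

definition generic :: "nat \<Rightarrow> (nat \<Rightarrow> real) \<Rightarrow> bool" where
  "generic n x \<longleftrightarrow> x \<in> quot_space n \<and>
     (\<forall>i\<in>{1..n}. \<forall>j\<in>{1..n}. i \<noteq> j \<longrightarrow> x i - x j \<notin> \<int>)"

text \<open>
  The alcove through a generic point. The floors are required to agree for all ordered pairs, and
  not only for positive roots, so that permuting coordinates visibly maps alcoves to alcoves.
\<close>

definition alcove_of :: "nat \<Rightarrow> (nat \<Rightarrow> real) \<Rightarrow> (nat \<Rightarrow> real) set" where
  "alcove_of n x =
     {y. generic n y \<and> (\<forall>i\<in>{1..n}. \<forall>j\<in>{1..n}. \<lfloor>y i - y j\<rfloor> = \<lfloor>x i - x j\<rfloor>)}"

lemma floor_minus_nonint:
  fixes d :: real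
  assumes "d \<notin> \<int>"
  shows "\<lfloor>- d\<rfloor> = - \<lfloor>d\<rfloor> - 1"
proof (rule floor_unique)
  have "of_int \<lfloor>d\<rfloor> \<noteq> d" using assms by (metis Ints_of_int)
  then have "of_int \<lfloor>d\<rfloor> < d" using of_int_floor_le[of d] by linarith
  then show "of_int (- \<lfloor>d\<rfloor> - 1) \<le> - d" "- d < of_int (- \<lfloor>d\<rfloor> - 1) + 1"
    unfolding of_int_diff of_int_minus of_int_1 by linarith+
qed

text \<open>
  Genericity needs checking only for pairs in increasing order, since $-d$ is an integer when
  $d$ is.
\<close>

lemma generic_iff:
  "generic n x \<longleftrightarrow> x \<in> quot_space n \<and> (\<forall>(i, j)\<in>pos_roots n. x i - x j \<notin> \<int>)"
proof -
  have "x i - x j \<notin> \<int>"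
    if "\<forall>(i, j)\<in>pos_roots n. x i - x j \<notin> \<int>" "i \<in> {1..n}" "j \<in> {1..n}" "i \<noteq> j" for i j
  proof (cases "i < j")
    case True
    then show ?thesis using that by (auto simp: pos_roots_def)
  next
    case False
    then have "x j - x i \<notin> \<int>" using that by (auto simp: pos_roots_def)
    then show ?thesis by (metis Ints_minus minus_diff_eq)
  qed
  then show ?thesis
    unfolding generic_def by (fastforce simp: pos_roots_def)
qed

text \<open>
  For non-integral $d$ the floor of $-d$ is determined by the floor of $d$; hence pairs
  in increasing order determine all pairs. This is what makes the description of alcoves by
  floors invariant under permutations of the coordinates.
\<close>

lemma floor_eq_all_pairs:
  assumes "generic n x" "generic n y"
    and "\<forall>(i, j)\<in>pos_roots n. \<lfloor>x i - x j\<rfloor> = \<lfloor>y i - y j\<rfloor>"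
    and "i \<in> {1..n}" "j \<in> {1..n}"
  shows "\<lfloor>x i - x j\<rfloor> = \<lfloor>y i - y j\<rfloor>"
proof (cases i j rule: linorder_cases)
  case less
  then show ?thesis using assms by (auto simp: pos_roots_def)
next
  case greater
  then have "(j, i) \<in> pos_roots n" using assms by (auto simp: pos_roots_def)
  then have "\<lfloor>x j - x i\<rfloor> = \<lfloor>y j - y i\<rfloor>" "x j - x i \<notin> \<int>" "y j - y i \<notin> \<int>"
    using assms by (auto simp: generic_iff)
  then show ?thesis
    using floor_minus_nonint[of "x j - x i"] floor_minus_nonint[of "y j - y i"] by simp
qed simp

lemma floor_eq_iff_same_integers_above:
  fixes u v :: real
  shows "\<lfloor>u\<rfloor> = \<lfloor>v\<rfloor> \<longleftrightarrow> (\<forall>a::int. u < of_int a \<longleftrightarrow> v < of_int a)"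
  by (metis floor_less_iff linorder_neq_iff order_less_irrefl)

lemma complement_Aff: "quot_space n - \<Union>(Aff n) = Collect (generic n)"
proof -
  have "x \<in> \<Union>(Aff n) \<longleftrightarrow> x \<in> quot_space n \<and> (\<exists>(i, j)\<in>pos_roots n. x i - x j \<in> \<int>)" for x
    unfolding Aff_def hyperplane_def pos_roots_def Ints_def by blast
  then show ?thesis
    by (intro set_eqI) (simp only: Diff_iff mem_Collect_eq generic_iff split_beta, blast)
qed

text \<open>
  Lying on the same side of $x_i - x_j = a$ for all integers $a$ means having the same
  floor of $x_i - x_j$.
\<close>

lemma alcoves_eq: "alcoves n = alcove_of n ` Collect (generic n)"
proof -
  define P where "P = {(i, j, a :: int). (i, j) \<in> pos_roots n}"
  have P: "quot_space n - (\<Union>(i, j, a)\<in>P. hyperplane n i j a) = Collect (generic n)"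
    unfolding complement_Aff[symmetric] Aff_def
    by (rule arg_cong[of _ _ "\<lambda>U. quot_space n - U"]) (auto simp: P_def pos_roots_def)
  have "{y \<in> Collect (generic n). \<forall>(i, j, a)\<in>P. x i - x j < of_int a \<longleftrightarrow> y i - y j < of_int a}
      = alcove_of n x" if x: "generic n x" for x
  proof (rule set_eqI)
    fix y :: "nat \<Rightarrow> real"
    have "(\<forall>(i, j, a)\<in>P. x i - x j < of_int a \<longleftrightarrow> y i - y j < of_int a) \<longleftrightarrow>
      (\<forall>(i, j)\<in>pos_roots n. \<lfloor>x i - x j\<rfloor> = \<lfloor>y i - y j\<rfloor>)"
      unfolding floor_eq_iff_same_integers_above P_def by auto
    also have "\<dots> \<longleftrightarrow> (\<forall>i\<in>{1..n}. \<forall>j\<in>{1..n}. \<lfloor>y i - y j\<rfloor> = \<lfloor>x i - x j\<rfloor>)" if "generic n y"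
      using floor_eq_all_pairs[OF x that] by (auto simp: pos_roots_def)
    finally show "y \<in> {y \<in> Collect (generic n).
        \<forall>(i, j, a)\<in>P. x i - x j < of_int a \<longleftrightarrow> y i - y j < of_int a} \<longleftrightarrow> y \<in> alcove_of n x"
      by (auto simp: alcove_of_def)
  qed
  then show ?thesis
    unfolding chambers_def complement_Aff
    using mem_components_complement_hyperplanes[of _ n P] unfolding P by (auto simp: image_iff)
qed

lemma self_mem_alcove_of: "generic n x \<Longrightarrow> x \<in> alcove_of n x"
  by (simp add: alcove_of_def)

definition same_shi_region :: "nat \<Rightarrow> (nat \<Rightarrow> real) \<Rightarrow> (nat \<Rightarrow> real) \<Rightarrow> bool" where
  "same_shi_region n x y \<longleftrightarrow> (\<forall>(i, j)\<in>pos_roots n.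
     (x i - x j < 0 \<longleftrightarrow> y i - y j < 0) \<and> (x i - x j < 1 \<longleftrightarrow> y i - y j < 1))"

text \<open>
  This translates containment of alcoves in a common Shi chamber into a condition on points. The
  second part is a separate statement because minimality in the definition of Shi alcoves refers
  to a chamber that is given in advance.
\<close>

lemma Shi_chamber_of_generic:
  assumes "generic n x"
  shows "\<exists>R\<in>chambers n (Shi n). \<forall>y. generic n y \<longrightarrow> (alcove_of n y \<subseteq> R \<longleftrightarrow> same_shi_region n x y)"
    and "R \<in> chambers n (Shi n) \<Longrightarrow> alcove_of n x \<subseteq> R \<Longrightarrow> generic n y \<Longrightarrow>
      alcove_of n y \<subseteq> R \<longleftrightarrow> same_shi_region n x y"
proof -
  define P where "P = (\<Union>(i, j)\<in>pos_roots n. {(i, j, 0 :: int), (i, j, 1)})"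
  define S where "S = quot_space n - \<Union>(Shi n)"
  have mem_P: "P = {(i, j, a). (i, j) \<in> pos_roots n \<and> a \<in> {0, 1}}"
    by (auto simp: P_def)
  have P: "quot_space n - (\<Union>(i, j, a)\<in>P. hyperplane n i j a) = S"
    unfolding S_def Shi_def mem_P
    by (rule arg_cong[of _ _ "\<lambda>U. quot_space n - U"]) (auto simp: pos_roots_def)
  have same: "(\<forall>(i, j, a)\<in>P. u i - u j < of_int a \<longleftrightarrow> v i - v j < of_int a) \<longleftrightarrow>
      same_shi_region n u v" for u v :: "nat \<Rightarrow> real"
  proof -
    have "(\<forall>(i, j, a)\<in>P. Q i j a) \<longleftrightarrow> (\<forall>(i, j)\<in>pos_roots n. Q i j 0 \<and> Q i j 1)" for Q
      unfolding mem_P by auto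
    then show ?thesis by (simp add: same_shi_region_def)
  qed
  have cham: "R \<in> chambers n (Shi n) \<longleftrightarrow> (\<exists>u\<in>S. R = {v\<in>S. same_shi_region n u v})" for R
    using mem_components_complement_hyperplanes[of R n P]
    unfolding P chambers_def S_def[symmetric] same .
  have "Shi n \<subseteq> Aff n" by (auto simp: Shi_def Aff_def)
  then have "Collect (generic n) \<subseteq> S"
    unfolding S_def complement_Aff[symmetric] by (intro Diff_mono Union_mono order_refl)
  then have S: "u \<in> S" if "generic n u" for u
    using that by (simp add: subset_eq)
  have alc: "same_shi_region n u v" if "v \<in> alcove_of n u" for u v
    unfolding same_shi_region_def
  proof (clarify)
    fix i j assume "(i, j) \<in> pos_roots n"
    then have "\<lfloor>u i - u j\<rfloor> = \<lfloor>v i - v j\<rfloor>" using that by (auto simp: alcove_of_def pos_roots_def)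
    then have "u i - u j < of_int a \<longleftrightarrow> v i - v j < of_int a" for a
      by (simp only: floor_eq_iff_same_integers_above)
    from this[of 0] this[of 1]
    show "(u i - u j < 0) = (v i - v j < 0) \<and> (u i - u j < 1) = (v i - v j < 1)" by simp
  qed
  have trans: "same_shi_region n u z" if "same_shi_region n u v" "same_shi_region n v z" for u v z
    using that unfolding same_shi_region_def split_beta by simp
  have sym: "same_shi_region n v u" if "same_shi_region n u v" for u v
    using that unfolding same_shi_region_def split_beta by simp
  have sub: "alcove_of n y \<subseteq> {v\<in>S. same_shi_region n u v} \<longleftrightarrow> same_shi_region n u y"
    if "generic n y" for u y
  proof
    assume "alcove_of n y \<subseteq> {v\<in>S. same_shi_region n u v}"
    then show "same_shi_region n u y" using self_mem_alcove_of[OF that] by auto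
  next
    assume "same_shi_region n u y"
    have "same_shi_region n u v" if "v \<in> alcove_of n y" for v
      by (rule trans[OF \<open>same_shi_region n u y\<close> alc[OF that]])
    moreover have "alcove_of n y \<subseteq> S" using S by (simp add: alcove_of_def subset_eq)
    ultimately show "alcove_of n y \<subseteq> {v\<in>S. same_shi_region n u v}"
      by (simp add: subset_eq)
  qed
  show "\<exists>R\<in>chambers n (Shi n). \<forall>y. generic n y \<longrightarrow> (alcove_of n y \<subseteq> R \<longleftrightarrow> same_shi_region n x y)"
  proof (rule bexI[of _ "{v\<in>S. same_shi_region n x v}"])
    show "{v\<in>S. same_shi_region n x v} \<in> chambers n (Shi n)"
      unfolding cham by (rule bexI[OF refl S[OF assms]])
  qed (use sub in blast)
  assume "R \<in> chambers n (Shi n)" "alcove_of n x \<subseteq> R" "generic n y"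
  then obtain u where R: "R = {v\<in>S. same_shi_region n u v}" unfolding cham by blast
  then have ux: "same_shi_region n u x" using sub[OF assms] \<open>alcove_of n x \<subseteq> R\<close> by simp
  show "alcove_of n y \<subseteq> R \<longleftrightarrow> same_shi_region n x y"
    unfolding R sub[OF \<open>generic n y\<close>] using trans[OF ux] trans[OF sym[OF ux]] by iprover
qed


section \<open>Counting the hyperplanes that separate an alcove from the fundamental one\<close>

lemma dominant_cone_iff:
  "x \<in> dominant_cone n \<longleftrightarrow> x \<in> quot_space n \<and> (\<forall>(i, j)\<in>pos_roots n. x j < x i)"
proof -
  have "x j < x i"
    if step: "\<forall>i. 1 \<le> i \<and> i < n \<longrightarrow> x (i + 1) < x i" and ij: "1 \<le> i" "i < j" "j \<le> n" for i j
  proof -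
    have "Suc i \<le> j" using ij by simp
    then show ?thesis using ij(3)
    proof (induction rule: dec_induct)
      case base
      then show ?case using step ij by simp
    next
      case (step m)
      then have "x (m + 1) < x m" using that(1) ij by simp
      then show ?case using step by simp
    qed
  qed
  then show ?thesis by (auto simp: dominant_cone_def pos_roots_def)
qed

text \<open>
  On the fundamental alcove the floor of every difference vanishes; the hyperplanes separating an
  alcove from it are therefore visible from that alcove alone.
\<close>

lemma fundamental_alcove_bounds:
  assumes "y \<in> fundamental_alcove n" "(i, j) \<in> pos_roots n"
  shows "0 < y i - y j" "y i - y j < 1"
proof -
  have dec: "y q < y p" if "1 \<le> p" "p < q" "q \<le> n" for p q
    using assms(1) that by (auto simp: fundamental_alcove_def dominant_cone_iff pos_roots_def)
  have ij: "1 \<le> i" "i < j" "j \<le> n" using assms(2) by (auto simp: pos_roots_def)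
  then show "0 < y i - y j" using dec by simp
  have "y i \<le> y 1" using dec[of 1 i] ij by (cases "i = 1") auto
  moreover have "y n \<le> y j" using dec[of j n] ij by (cases "j = n") auto
  ultimately show "y i - y j < 1" using assms(1) by (simp add: fundamental_alcove_def)
qed

lemma fundamental_alcove_nonempty:
  assumes "n \<ge> 1"
  shows "fundamental_alcove n \<noteq> {}"
proof -
  obtain y where y: "y \<in> quot_space n"
    "\<forall>i\<in>{1..n}. \<forall>j\<in>{1..n}. y i - y j = - (real i / real n) - - (real j / real n)"
    using ex_quot_space_differences[OF assms, of "\<lambda>i. - (real i / real n)"] by blast
  have "y j < y i" if "(i, j) \<in> pos_roots n" for i j
  proof -
    have "y i - y j = (real j - real i) / real n"
      using y(2) that by (simp add: pos_roots_def diff_divide_distrib)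
    also have "\<dots> > 0" using that by (simp add: pos_roots_def)
    finally show ?thesis by simp
  qed
  moreover have "y 1 - y n < 1"
  proof -
    have "y 1 - y n = 1 - 1 / real n" using y(2) assms by simp
    then show ?thesis using assms by simp
  qed
  ultimately have "y \<in> fundamental_alcove n"
    using y(1) by (auto simp: fundamental_alcove_def dominant_cone_iff)
  then show ?thesis by blast
qed

text \<open>
  The condition under which \<open>a\<close> lies strictly between \<open>d\<close> and the interval $(0,1)$, or at
  the endpoint of that interval facing \<open>d\<close>.
\<close>

definition crosses :: "int \<Rightarrow> real \<Rightarrow> bool" where
  "crosses a d \<longleftrightarrow> a \<le> 0 \<and> d < of_int a \<or> 1 \<le> a \<and> of_int a < d"

lemma separates_fundamental_alcove_iff:
  assumes "n \<ge> 1" "generic n x" "(i, j) \<in> pos_roots n"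
  shows "separates n (hyperplane n i j a) (alcove_of n x) (fundamental_alcove n) \<longleftrightarrow>
    crosses a (x i - x j)"
proof -
  have lt: "z i - z j < of_int a \<longleftrightarrow> x i - x j < of_int a"
    and ne: "z i - z j \<noteq> of_int a" if "z \<in> alcove_of n x" for z
  proof -
    have "\<lfloor>z i - z j\<rfloor> = \<lfloor>x i - x j\<rfloor>" "generic n z"
      using that assms(3) by (auto simp: alcove_of_def pos_roots_def)
    then show "z i - z j < of_int a \<longleftrightarrow> x i - x j < of_int a"
      by (simp only: floor_eq_iff_same_integers_above)
    have "z i - z j \<notin> \<int>" using \<open>generic n z\<close> assms(3) unfolding generic_iff by blast
    then show "z i - z j \<noteq> of_int a" by auto
  qed
  have gt: "z i - z j > of_int a \<longleftrightarrow> x i - x j > of_int a" if "z \<in> alcove_of n x" for z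
    using lt[OF that] ne[OF that] ne[OF self_mem_alcove_of[OF assms(2)]] by linarith
  have x: "x \<in> alcove_of n x" by (rule self_mem_alcove_of[OF assms(2)])
  obtain y where y: "y \<in> fundamental_alcove n"
    using fundamental_alcove_nonempty[OF assms(1)] by blast
  have below: "(\<forall>y\<in>fundamental_alcove n. y i - y j < of_int a) \<longleftrightarrow> 1 \<le> a"
  proof
    assume "\<forall>y\<in>fundamental_alcove n. y i - y j < of_int a"
    then have "y i - y j < of_int a" using y by (rule bspec)
    with fundamental_alcove_bounds(1)[OF y assms(3)] have "(0::real) < of_int a" by linarith
    then show "1 \<le> a" by simp
  next
    assume "1 \<le> a"
    then have "(1::real) \<le> of_int a" by simp
    show "\<forall>y\<in>fundamental_alcove n. y i - y j < of_int a"
    proof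
      fix y assume "y \<in> fundamental_alcove n"
      from fundamental_alcove_bounds(2)[OF this assms(3)] \<open>(1::real) \<le> of_int a\<close>
      show "y i - y j < of_int a" by linarith
    qed
  qed
  have above: "(\<forall>y\<in>fundamental_alcove n. y i - y j > of_int a) \<longleftrightarrow> a \<le> 0"
  proof
    assume "\<forall>y\<in>fundamental_alcove n. y i - y j > of_int a"
    then have "y i - y j > of_int a" using y by (rule bspec)
    with fundamental_alcove_bounds(2)[OF y assms(3)] have "of_int a < (1::real)" by linarith
    then show "a \<le> 0" by simp
  next
    assume "a \<le> 0"
    then have "of_int a \<le> (0::real)" by simp
    show "\<forall>y\<in>fundamental_alcove n. y i - y j > of_int a"
    proof
      fix y assume "y \<in> fundamental_alcove n"
      from fundamental_alcove_bounds(1)[OF this assms(3)] \<open>of_int a \<le> (0::real)\<close>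
      show "y i - y j > of_int a" by linarith
    qed
  qed
  have "alcove_of n x \<subseteq> quot_space n" "fundamental_alcove n \<subseteq> quot_space n"
    by (auto simp: alcove_of_def generic_def fundamental_alcove_def dominant_cone_def)
  then have "separates n (hyperplane n i j a) (alcove_of n x) (fundamental_alcove n) \<longleftrightarrow>
    (\<forall>z\<in>alcove_of n x. z i - z j < of_int a) \<and> a \<le> 0 \<or>
    (\<forall>z\<in>alcove_of n x. z i - z j > of_int a) \<and> 1 \<le> a"
    unfolding above[symmetric] below[symmetric]
    by (intro separates_iff fundamental_alcove_nonempty assms(1)) (use x in blast)+
  also have "(\<forall>z\<in>alcove_of n x. z i - z j < of_int a) \<longleftrightarrow> x i - x j < of_int a"
    using x lt by metis
  also have "(\<forall>z\<in>alcove_of n x. z i - z j > of_int a) \<longleftrightarrow> x i - x j > of_int a"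
    using x gt by metis
  finally show ?thesis by (auto simp: crosses_def)
qed

lemma crossed_integers:
  assumes "d \<notin> \<int>"
  shows "{a. crosses a d} = {1..\<lfloor>d\<rfloor>} \<union> {\<lfloor>d\<rfloor> + 1..0}"
proof -
  have "of_int a < d \<longleftrightarrow> a \<le> \<lfloor>d\<rfloor>" "d < of_int a \<longleftrightarrow> \<lfloor>d\<rfloor> + 1 \<le> a" for a
  proof -
    have "d \<noteq> of_int a" using assms by auto
    then show "of_int a < d \<longleftrightarrow> a \<le> \<lfloor>d\<rfloor>" by (auto simp: le_floor_iff)
    show "d < of_int a \<longleftrightarrow> \<lfloor>d\<rfloor> + 1 \<le> a" by (simp add: floor_less_iff[symmetric] add1_zle_eq)
  qed
  then show ?thesis unfolding crosses_def by auto
qed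

lemma card_crossed_integers: "d \<notin> \<int> \<Longrightarrow> card {a. crosses a d} = nat \<bar>\<lfloor>d\<rfloor>\<bar>"
  by (subst crossed_integers, assumption, subst card_Un_disjoint) auto

lemma card_crossed_Shi_integers:
  "card {a \<in> {0, 1}. crosses a d} = of_bool (d < 0 \<or> 1 < d)"
proof -
  have "{a \<in> {0, 1}. crosses a d} = (if d < 0 then {0} else if 1 < d then {1} else {})"
    by (auto simp: crosses_def)
  then show ?thesis by simp
qed

lemma finite_pos_roots: "finite (pos_roots n)"
  by (rule finite_subset[of _ "{1..n} \<times> {1..n}"]) (auto simp: pos_roots_def)

text \<open>
  The three statistics differ only in which roots and which levels they admit, so one count serves
  the length (all roots, all levels), \<open>shi\<close> (all roots, levels 0 and 1) and \<open>ish\<close> (the roots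
  ending in \<open>n\<close>, all levels).
\<close>

lemma card_separating_hyperplanes:
  assumes "n \<ge> 1" "generic n x" "R \<subseteq> pos_roots n"
  shows "card {H \<in> {hyperplane n i j a | i j a. (i, j) \<in> R \<and> a \<in> Q}.
      separates n H (alcove_of n x) (fundamental_alcove n)} =
    (\<Sum>(i, j)\<in>R. card {a \<in> Q. crosses a (x i - x j)})"
proof -
  define T where "T = (SIGMA p:R. {a \<in> Q. crosses a (x (fst p) - x (snd p))})"
  define h where "h = (\<lambda>(p, a). hyperplane n (fst p) (snd p) a)"
  have sep: "separates n (hyperplane n i j a) (alcove_of n x) (fundamental_alcove n) \<longleftrightarrow>
      crosses a (x i - x j)" if "(i, j) \<in> R" for i j a
    by (rule separates_fundamental_alcove_iff[OF assms(1,2) subsetD[OF assms(3) that]])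
  have "{H \<in> {hyperplane n i j a | i j a. (i, j) \<in> R \<and> a \<in> Q}.
      separates n H (alcove_of n x) (fundamental_alcove n)} = h ` T"
  proof (intro set_eqI iffI)
    fix H assume "H \<in> {H \<in> {hyperplane n i j a | i j a. (i, j) \<in> R \<and> a \<in> Q}.
      separates n H (alcove_of n x) (fundamental_alcove n)}"
    then obtain i j a where H: "H = hyperplane n i j a" "(i, j) \<in> R" "a \<in> Q"
      "separates n (hyperplane n i j a) (alcove_of n x) (fundamental_alcove n)"
      by blast
    then have "((i, j), a) \<in> T" "H = h ((i, j), a)" by (simp_all add: T_def h_def sep)
    then show "H \<in> h ` T" by blast
  next
    fix H assume "H \<in> h ` T"
    then obtain i j a where "((i, j), a) \<in> T" "H = h ((i, j), a)" by auto
    then have "H = hyperplane n i j a" "(i, j) \<in> R" "a \<in> Q"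
      "separates n H (alcove_of n x) (fundamental_alcove n)"
      by (simp_all add: T_def h_def sep)
    then show "H \<in> {H \<in> {hyperplane n i j a | i j a. (i, j) \<in> R \<and> a \<in> Q}.
      separates n H (alcove_of n x) (fundamental_alcove n)}" by blast
  qed
  moreover have "inj_on h T"
  proof (rule inj_onI)
    fix s t assume st: "s \<in> T" "t \<in> T" "h s = h t"
    then have "fst s \<in> pos_roots n" "fst t \<in> pos_roots n" using assms(3) by (auto simp: T_def)
    then have "(fst (fst s), snd (fst s), snd s) = (fst (fst t), snd (fst t), snd t)"
      using st(3)
      by (intro inj_on_hyperplane[of n, unfolded inj_on_def, rule_format])
         (simp_all add: h_def split_beta)
    then show "s = t" by (simp add: prod_eq_iff)
  qed
  moreover have "card T = (\<Sum>p\<in>R. card {a \<in> Q. crosses a (x (fst p) - x (snd p))})"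
    unfolding T_def
  proof (rule card_SigmaI)
    show "finite R" using assms(3) finite_pos_roots by (rule finite_subset)
    show "\<forall>p\<in>R. finite {a \<in> Q. crosses a (x (fst p) - x (snd p))}"
    proof
      fix p assume "p \<in> R"
      then have "x (fst p) - x (snd p) \<notin> \<int>"
        using assms(2,3) unfolding generic_iff by (simp add: subset_eq split_beta)
      then have "finite {a. crosses a (x (fst p) - x (snd p))}"
        by (simp add: crossed_integers)
      then show "finite {a \<in> Q. crosses a (x (fst p) - x (snd p))}"
        by (rule rev_finite_subset) auto
    qed
  qed
  ultimately show ?thesis by (simp add: card_image split_beta)
qed

lemma alcove_length_alcove_of:
  assumes "n \<ge> 1" "generic n x"
  shows "alcove_length n (alcove_of n x) = (\<Sum>(i, j)\<in>pos_roots n. nat \<bar>\<lfloor>x i - x j\<rfloor>\<bar>)"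
proof -
  have "Aff n = {hyperplane n i j a | i j a. (i, j) \<in> pos_roots n \<and> a \<in> UNIV}"
    by (simp add: Aff_def pos_roots_def)
  then have "alcove_length n (alcove_of n x) =
      (\<Sum>(i, j)\<in>pos_roots n. card {a \<in> UNIV. crosses a (x i - x j)})"
    unfolding alcove_length_def by (simp only: card_separating_hyperplanes[OF assms order_refl])
  also have "\<dots> = (\<Sum>(i, j)\<in>pos_roots n. nat \<bar>\<lfloor>x i - x j\<rfloor>\<bar>)"
    using assms(2) by (intro sum.cong refl) (auto simp: generic_iff card_crossed_integers)
  finally show ?thesis .
qed

lemma shi_alcove_of:
  assumes "n \<ge> 1" "generic n x"
  shows "shi n (alcove_of n x) = (\<Sum>(i, j)\<in>pos_roots n. of_bool (x i - x j < 0 \<or> 1 < x i - x j))"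
proof -
  have "Shi n = {hyperplane n i j a | i j a. (i, j) \<in> pos_roots n \<and> a \<in> {0, 1}}"
    by (simp add: Shi_def pos_roots_def conj_assoc)
  then show ?thesis
    unfolding shi_def
    by (simp only: card_separating_hyperplanes[OF assms order_refl] card_crossed_Shi_integers)
qed

section \<open>Sorting the coordinates of an alcove\<close>

lemma perm_act_inv:
  assumes "w permutes S"
  shows "perm_act (inv w) x = x \<circ> w"
  using assms by (simp add: perm_act_def fun_eq_iff permutes_inv_inv)

lemma comp_permutes_mem_quot_space:
  assumes "w permutes {1..n}" "x \<in> quot_space n"
  shows "x \<circ> w \<in> quot_space n"
proof -
  have "(\<Sum>i=1..n. x (w i)) = (\<Sum>i=1..n. x i)"
    using sum.permute[OF assms(1), of x] by (simp add: comp_def)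
  then show ?thesis
    using assms permutes_not_in[OF assms(1)] by (simp add: quot_space_def)
qed

lemma comp_permutes_generic:
  assumes "w permutes {1..n}" "generic n x"
  shows "generic n (x \<circ> w)"
  unfolding generic_def
proof (intro conjI ballI impI)
  show "x \<circ> w \<in> quot_space n"
    using assms comp_permutes_mem_quot_space by (simp add: generic_def)
  fix i j assume ij: "i \<in> {1..n}" "j \<in> {1..n}" "i \<noteq> j"
  then have "w i \<in> {1..n}" "w j \<in> {1..n}" "w i \<noteq> w j"
    using permutes_in_image[OF assms(1)] permutes_inj[OF assms(1)] by (auto dest: injD)
  then show "(x \<circ> w) i - (x \<circ> w) j \<notin> \<int>" using assms(2) by (simp add: generic_def)
qed

lemma comp_permutes_image_alcove_of:
  assumes "w permutes {1..n}"
  shows "(\<lambda>y. y \<circ> w) ` alcove_of n x = alcove_of n (x \<circ> w)"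
proof -
  have sub: "y \<circ> v \<in> alcove_of n (z \<circ> v)" if v: "v permutes {1..n}" and y: "y \<in> alcove_of n z" for v y z
    using y comp_permutes_generic[OF v, of y] permutes_in_image[OF v] by (auto simp: alcove_of_def)
  have inv: "inv w permutes {1..n}" using assms by (rule permutes_inv)
  have cancel: "z \<circ> w \<circ> inv w = z" "z \<circ> inv w \<circ> w = z" for z :: "nat \<Rightarrow> real"
    using permutes_inv_o[OF assms] by (simp_all add: comp_assoc)
  show ?thesis
  proof
    show "(\<lambda>y. y \<circ> w) ` alcove_of n x \<subseteq> alcove_of n (x \<circ> w)" using sub[OF assms] by blast
    show "alcove_of n (x \<circ> w) \<subseteq> (\<lambda>y. y \<circ> w) ` alcove_of n x"
    proof
      fix y assume "y \<in> alcove_of n (x \<circ> w)"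
      then have "y \<circ> inv w \<in> alcove_of n x" using sub[OF inv, of y "x \<circ> w"] by (simp add: cancel)
      then show "y \<in> (\<lambda>y. y \<circ> w) ` alcove_of n x"
        by (rule rev_image_eqI) (simp add: cancel)
    qed
  qed
qed

definition sorts :: "nat \<Rightarrow> (nat \<Rightarrow> nat) \<Rightarrow> (nat \<Rightarrow> real) \<Rightarrow> bool" where
  "sorts n w x \<longleftrightarrow> w permutes {1..n} \<and> (\<forall>(i, j)\<in>pos_roots n. x (w j) < x (w i))"

lemma mem_image_dominant_cone_iff:
  assumes "w permutes {1..n}" "x \<in> quot_space n"
  shows "x \<in> perm_act w ` dominant_cone n \<longleftrightarrow> sorts n w x"
proof -
  have act: "perm_act w y = y \<circ> inv w" for y by (simp add: perm_act_def fun_eq_iff)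
  have "x \<in> perm_act w ` dominant_cone n \<longleftrightarrow> x \<circ> w \<in> dominant_cone n"
  proof
    assume "x \<in> perm_act w ` dominant_cone n"
    then show "x \<circ> w \<in> dominant_cone n"
      using permutes_inv_o[OF assms(1)] by (auto simp: act comp_assoc)
  next
    assume "x \<circ> w \<in> dominant_cone n"
    moreover have "x = perm_act w (x \<circ> w)"
      using permutes_inv_o[OF assms(1)] by (simp add: act comp_assoc)
    ultimately show "x \<in> perm_act w ` dominant_cone n" by blast
  qed
  then show ?thesis
    using assms comp_permutes_mem_quot_space by (simp add: dominant_cone_iff sorts_def)
qed

text \<open>
  A sorting permutation is the inverse of the rank function, which depends on \<open>x\<close> only. This
  gives its uniqueness, and suggests the construction for its existence.
\<close>

lemma rank_of_sorted_entry:
  assumes "sorts n w x" "i \<in> {1..n}"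
  shows "card {p \<in> {1..n}. x (w i) \<le> x p} = i"
proof -
  have w: "w permutes {1..n}" using assms by (simp add: sorts_def)
  have "{p \<in> {1..n}. x (w i) \<le> x p} = w ` {1..i}"
  proof (rule set_eqI)
    fix p
    show "p \<in> {p \<in> {1..n}. x (w i) \<le> x p} \<longleftrightarrow> p \<in> w ` {1..i}"
    proof (cases "p \<in> {1..n}")
      case True
      then obtain q where q: "q \<in> {1..n}" "p = w q"
        using permutes_image[OF w] by blast
      have "x (w i) \<le> x (w q) \<longleftrightarrow> q \<le> i"
      proof (cases i q rule: linorder_cases)
        case less
        then have "x (w q) < x (w i)" using assms q by (auto simp: sorts_def pos_roots_def)
        then show ?thesis using less by simp
      next
        case greater
        then have "x (w i) < x (w q)" using assms q by (auto simp: sorts_def pos_roots_def)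
        then show ?thesis using greater by simp
      qed simp
      moreover have "w q \<in> w ` {1..i} \<longleftrightarrow> q \<in> {1..i}"
        using permutes_inj[OF w] by (rule inj_image_mem_iff)
      ultimately show ?thesis using q True by simp
    next
      case False
      then show ?thesis using permutes_in_image[OF w] assms(2) by force
    qed
  qed
  then show ?thesis
    using card_image[OF inj_on_subset[OF permutes_inj[OF w] subset_UNIV], of "{1..i}"] by simp
qed

lemma sorts_unique:
  assumes "sorts n v x" "sorts n w x"
  shows "v = w"
proof
  fix i
  show "v i = w i"
  proof (cases "i \<in> {1..n}")
    case True
    have v: "v permutes {1..n}" and w: "w permutes {1..n}" using assms by (auto simp: sorts_def)
    obtain j where j: "j \<in> {1..n}" "v i = w j"
      using permutes_image[OF w] permutes_in_image[OF v, of i] True by (metis image_iff)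
    then have "i = j"
      using rank_of_sorted_entry[OF assms(1) True] rank_of_sorted_entry[OF assms(2) j(1)] by simp
    then show ?thesis using j by simp
  next
    case False
    then show ?thesis using assms by (auto simp: sorts_def permutes_not_in)
  qed
qed

lemma sorts_exists:
  assumes "generic n x"
  shows "\<exists>w. sorts n w x"
proof -
  \<comment> \<open>Ranks are counted from the largest coordinate, as the sorted order is decreasing.\<close>
  define rank where "rank = (\<lambda>q. if q \<in> {1..n} then card {p \<in> {1..n}. x q \<le> x p} else q)"
  have less: "rank p < rank q" if "p \<in> {1..n}" "q \<in> {1..n}" "x p > x q" for p q
  proof -
    have fin: "finite {r \<in> {1..n}. x q \<le> x r}" by simp
    have "q \<in> {r \<in> {1..n}. x q \<le> x r}" "q \<notin> {r \<in> {1..n}. x p \<le> x r}" using that by auto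
    moreover have "{r \<in> {1..n}. x p \<le> x r} \<subseteq> {r \<in> {1..n}. x q \<le> x r}" using that by auto
    ultimately have "{r \<in> {1..n}. x p \<le> x r} \<subset> {r \<in> {1..n}. x q \<le> x r}" by blast
    from psubset_card_mono[OF fin this] show ?thesis
      using that unfolding rank_def by (simp only: if_True)
  qed
  have distinct: "x p \<noteq> x q" if "p \<in> {1..n}" "q \<in> {1..n}" "p \<noteq> q" for p q
    using assms that unfolding generic_def by (metis Ints_0 diff_self)
  have into: "rank q \<in> {1..n}" if "q \<in> {1..n}" for q
  proof -
    have "card {p \<in> {1..n}. x q \<le> x p} \<le> card {1..n}" by (rule card_mono) auto
    moreover have "card {p \<in> {1..n}. x q \<le> x p} \<noteq> 0" using that by auto
    ultimately have "card {p \<in> {1..n}. x q \<le> x p} \<in> {1..n}"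
      unfolding atLeastAtMost_iff card_atLeastAtMost by linarith
    then show ?thesis using that unfolding rank_def by (simp only: if_True)
  qed
  have "inj_on rank {1..n}"
    by (rule inj_onI) (metis less distinct linorder_neqE less_irrefl)
  moreover from this have "rank ` {1..n} = {1..n}"
    using into by (intro endo_inj_surj) auto
  ultimately have rank: "rank permutes {1..n}"
    by (intro bij_imp_permutes) (auto simp: bij_betw_def rank_def)
  have "x (inv rank j) < x (inv rank i)" if "(i, j) \<in> pos_roots n" for i j
  proof (rule ccontr)
    assume neg: "\<not> ?thesis"
    have inv: "inv rank i \<in> {1..n}" "inv rank j \<in> {1..n}"
      using that permutes_in_image[OF permutes_inv[OF rank]] by (auto simp: pos_roots_def)
    have rr: "rank (inv rank i) = i" "rank (inv rank j) = j"
      using permutes_inverses(1)[OF rank] by auto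
    then have "inv rank i \<noteq> inv rank j" using that by (auto simp: pos_roots_def)
    then have "x (inv rank i) < x (inv rank j)" using distinct[OF inv] neg by simp
    then have "j < i" using less[OF inv(2,1)] rr by simp
    then show False using that by (simp add: pos_roots_def)
  qed
  then have "sorts n (inv rank) x" using permutes_inv[OF rank] by (auto simp: sorts_def)
  then show ?thesis by blast
qed

lemma pos_iff_floor_nonneg:
  fixes d :: real assumes "d \<notin> \<int>"
  shows "0 < d \<longleftrightarrow> 0 \<le> \<lfloor>d\<rfloor>" "1 < d \<longleftrightarrow> 1 \<le> \<lfloor>d\<rfloor>"
proof -
  have "d \<noteq> 0" "d \<noteq> 1" using assms by auto
  then show "0 < d \<longleftrightarrow> 0 \<le> \<lfloor>d\<rfloor>" "1 < d \<longleftrightarrow> 1 \<le> \<lfloor>d\<rfloor>" by linarith+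
qed

lemma comp_sorts:
  assumes "sorts n w x" "generic n x" "(i, j) \<in> pos_roots n"
  shows "x (w i) - x (w j) \<notin> \<int>" "0 < x (w i) - x (w j)"
proof -
  have "generic n (x \<circ> w)"
    using assms(1,2) comp_permutes_generic by (simp add: sorts_def)
  then show "x (w i) - x (w j) \<notin> \<int>" using assms(3) by (auto simp: generic_iff)
  show "0 < x (w i) - x (w j)" using assms(1,3) by (auto simp: sorts_def)
qed

lemma alcove_of_comp_floor:
  assumes "w permutes {1..n}" "y \<in> alcove_of n x" "(i, j) \<in> pos_roots n"
  shows "\<lfloor>y (w i) - y (w j)\<rfloor> = \<lfloor>x (w i) - x (w j)\<rfloor>"
proof -
  have "w i \<in> {1..n}" "w j \<in> {1..n}"
    using assms(3) permutes_in_image[OF assms(1)] by (auto simp: pos_roots_def)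
  then show ?thesis using assms(2) by (simp add: alcove_of_def)
qed

lemma sorts_alcove_of:
  assumes "sorts n w x" "generic n x" "y \<in> alcove_of n x"
  shows "sorts n w y"
proof -
  have w: "w permutes {1..n}" using assms(1) by (simp add: sorts_def)
  have gy: "generic n y" using assms(3) by (simp add: alcove_of_def)
  have "y (w j) < y (w i)" if "(i, j) \<in> pos_roots n" for i j
  proof -
    have "(y \<circ> w) i - (y \<circ> w) j \<notin> \<int>"
      using comp_permutes_generic[OF w gy] that unfolding generic_iff by blast
    then have "y (w i) - y (w j) \<notin> \<int>" by simp
    moreover have "0 \<le> \<lfloor>y (w i) - y (w j)\<rfloor>"
      using comp_sorts(2)[OF assms(1,2) that] by (simp add: alcove_of_comp_floor[OF w assms(3) that])
    ultimately have "0 < y (w i) - y (w j)"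
      using pos_iff_floor_nonneg(1) by blast
    then show ?thesis by simp
  qed
  then show ?thesis using w by (auto simp: sorts_def)
qed

lemma alcove_perm_alcove_of:
  assumes "sorts n w x" "generic n x"
  shows "alcove_perm n (alcove_of n x) = w"
  unfolding alcove_perm_def
proof (rule the_equality)
  have quot: "y \<in> quot_space n" if "y \<in> alcove_of n x" for y
    using that by (simp add: alcove_of_def generic_def)
  have w: "w permutes {1..n}" using assms(1) by (simp add: sorts_def)
  then show "w permutes {1..n} \<and> alcove_of n x \<subseteq> perm_act w ` dominant_cone n"
    using mem_image_dominant_cone_iff[OF w quot] sorts_alcove_of[OF assms] by (simp add: subset_eq)
  fix v assume v: "v permutes {1..n} \<and> alcove_of n x \<subseteq> perm_act v ` dominant_cone n"
  have x: "x \<in> alcove_of n x" by (rule self_mem_alcove_of[OF assms(2)])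
  with v have "x \<in> perm_act v ` dominant_cone n" by blast
  then have "sorts n v x" using v mem_image_dominant_cone_iff[OF _ quot[OF x]] by simp
  then show "v = w" using assms(1) by (rule sorts_unique)
qed

lemma dominant_translate_alcove_of:
  assumes "sorts n w x" "generic n x"
  shows "dominant_translate n (alcove_of n x) = alcove_of n (x \<circ> w)"
proof -
  have "w permutes {1..n}" using assms(1) by (simp add: sorts_def)
  then show ?thesis
    unfolding dominant_translate_def alcove_perm_alcove_of[OF assms]
    by (simp add: perm_act_inv comp_permutes_image_alcove_of)
qed

lemma alcove_ideal_alcove_of:
  assumes "sorts n w x" "generic n x"
  shows "alcove_ideal n (alcove_of n x) = {(i, j) \<in> pos_roots n. 1 < x (w i) - x (w j)}"
proof -
  have w: "w permutes {1..n}" using assms(1) by (simp add: sorts_def)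
  have gxw: "generic n (x \<circ> w)" by (rule comp_permutes_generic[OF w assms(2)])
  have "(\<forall>y\<in>alcove_of n (x \<circ> w). 1 < y i - y j) \<longleftrightarrow> 1 < x (w i) - x (w j)"
    if ij: "(i, j) \<in> pos_roots n" for i j
  proof
    assume "\<forall>y\<in>alcove_of n (x \<circ> w). 1 < y i - y j"
    then have "1 < (x \<circ> w) i - (x \<circ> w) j" using self_mem_alcove_of[OF gxw] by blast
    then show "1 < x (w i) - x (w j)" by simp
  next
    assume *: "1 < x (w i) - x (w j)"
    show "\<forall>y\<in>alcove_of n (x \<circ> w). 1 < y i - y j"
    proof
      fix y assume y: "y \<in> alcove_of n (x \<circ> w)"
      then have "generic n y" by (simp add: alcove_of_def)
      then have "y i - y j \<notin> \<int>" using ij unfolding generic_iff by blast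
      moreover have "\<lfloor>y i - y j\<rfloor> = \<lfloor>x (w i) - x (w j)\<rfloor>"
        using alcove_of_comp_floor[OF permutes_id y ij] by simp
      ultimately show "1 < y i - y j"
        using * comp_sorts(1)[OF assms ij] by (simp add: pos_iff_floor_nonneg(2))
    qed
  qed
  then show ?thesis
    unfolding alcove_ideal_def dominant_translate_alcove_of[OF assms] by auto
qed

section \<open>The statistics of an alcove in sorted coordinates\<close>

text \<open>
  A permutation maps unordered pairs of indices bijectively to unordered pairs; a positive root is
  such a pair written in increasing order.
\<close>

lemma sum_pos_roots_permute:
  assumes "w permutes {1..n}"
  shows "(\<Sum>(p, q)\<in>pos_roots n. g p q) =
    (\<Sum>(i, j)\<in>pos_roots n. if w i < w j then g (w i) (w j) else g (w j) (w i))"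
proof -
  \<comment> \<open>The positive root underlying the image of \<open>(i, j)\<close> under \<open>w\<close>.\<close>
  define \<beta> where "\<beta> = (\<lambda>(i, j). if w i < w j then (w i, w j) else (w j, w i))"
  have inj: "w i = w j \<longleftrightarrow> i = j" for i j using permutes_inj[OF assms] by (simp add: inj_eq)
  have into: "\<beta> ` pos_roots n \<subseteq> pos_roots n"
  proof (rule image_subsetI)
    fix r assume "r \<in> pos_roots n"
    moreover obtain i j where r: "r = (i, j)" by (cases r)
    ultimately have "w i \<in> {1..n}" "w j \<in> {1..n}" "w i \<noteq> w j"
      using permutes_in_image[OF assms] inj by (auto simp: pos_roots_def)
    then show "\<beta> r \<in> pos_roots n" by (auto simp: r \<beta>_def pos_roots_def)
  qed
  have "inj_on \<beta> (pos_roots n)"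
    by (rule inj_onI) (auto simp: \<beta>_def pos_roots_def inj split: if_splits)
  then have "bij_betw \<beta> (pos_roots n) (pos_roots n)"
    using endo_inj_surj[OF finite_pos_roots into] by (simp add: bij_betw_def)
  then have "(\<Sum>(p, q)\<in>pos_roots n. g p q) = (\<Sum>r\<in>pos_roots n. case \<beta> r of (p, q) \<Rightarrow> g p q)"
    by (rule sum.reindex_bij_betw[symmetric])
  also have "\<dots> = (\<Sum>(i, j)\<in>pos_roots n. if w i < w j then g (w i) (w j) else g (w j) (w i))"
    by (rule sum.cong) (auto simp: \<beta>_def)
  finally show ?thesis .
qed

text \<open>
  In sorted coordinates every difference is positive. At an inversion the original difference is
  its negative $-d$, and the floor of $-d$ has absolute value $\lfloor d\rfloor + 1$: hence the
  extra one per inversion. For a fixed permutation the length is thus increasing in the floors.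
\<close>

lemma alcove_length_sorted:
  assumes "n \<ge> 1" "sorts n w x" "generic n x"
  shows "alcove_length n (alcove_of n x) =
    (\<Sum>(i, j)\<in>pos_roots n. nat \<lfloor>x (w i) - x (w j)\<rfloor> + of_bool (w j < w i))"
proof -
  have w: "w permutes {1..n}" using assms(2) by (simp add: sorts_def)
  have "(if w i < w j then nat \<bar>\<lfloor>x (w i) - x (w j)\<rfloor>\<bar> else nat \<bar>\<lfloor>x (w j) - x (w i)\<rfloor>\<bar>) =
      nat \<lfloor>x (w i) - x (w j)\<rfloor> + of_bool (w j < w i)" if ij: "(i, j) \<in> pos_roots n" for i j
  proof -
    define d where "d = x (w i) - x (w j)"
    have d: "d \<notin> \<int>" "0 < d" using comp_sorts[OF assms(2,3) ij] by (auto simp: d_def)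
    then have fl: "0 \<le> \<lfloor>d\<rfloor>" using pos_iff_floor_nonneg(1) by blast
    have "x (w j) - x (w i) = - d" by (simp add: d_def)
    then have "\<lfloor>x (w j) - x (w i)\<rfloor> = - \<lfloor>d\<rfloor> - 1" using floor_minus_nonint[OF d(1)] by simp
    moreover have "w i \<noteq> w j" using ij permutes_inj[OF w] by (auto simp: pos_roots_def inj_eq)
    moreover have "nat \<bar>- \<lfloor>d\<rfloor> - 1\<bar> = nat \<lfloor>d\<rfloor> + 1" "nat \<bar>\<lfloor>d\<rfloor>\<bar> = nat \<lfloor>d\<rfloor>"
      using fl by linarith+
    ultimately show ?thesis
      unfolding d_def[symmetric] by (cases "w i < w j") (simp_all only: if_True if_False, simp_all)
  qed
  then show ?thesis
    unfolding alcove_length_alcove_of[OF assms(1,3)]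
    by (intro trans[OF sum_pos_roots_permute[OF w] sum.cong]) auto
qed

text \<open>
  At an inversion exactly the level 0 separates, at a non-inversion the level 1 does if the
  difference exceeds it; so each pair contributes at most one hyperplane.
\<close>

lemma shi_sorted:
  assumes "n \<ge> 1" "sorts n w x" "generic n x"
  shows "shi n (alcove_of n x) =
    card {(i, j) \<in> pos_roots n. w j < w i \<or> 1 < x (w i) - x (w j)}"
proof -
  have w: "w permutes {1..n}" using assms(2) by (simp add: sorts_def)
  have key: "(if w i < w j then of_bool (x (w i) - x (w j) < 0 \<or> 1 < x (w i) - x (w j))
      else of_bool (x (w j) - x (w i) < 0 \<or> 1 < x (w j) - x (w i))) =
      (of_bool (w j < w i \<or> 1 < x (w i) - x (w j)) :: nat)" if ij: "(i, j) \<in> pos_roots n" for i j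
  proof -
    have "w i \<noteq> w j" using ij permutes_inj[OF w] by (auto simp: pos_roots_def inj_eq)
    then show ?thesis using comp_sorts(2)[OF assms(2,3) ij] by auto
  qed
  have "shi n (alcove_of n x) =
      (\<Sum>p\<in>pos_roots n. of_bool (w (snd p) < w (fst p) \<or> 1 < x (w (fst p)) - x (w (snd p))))"
    unfolding shi_alcove_of[OF assms(1,3)]
    by (intro trans[OF sum_pos_roots_permute[OF w] sum.cong] refl)
       (clarify, simp only: prod.case fst_conv snd_conv key)
  also have "\<dots> = card (pos_roots n \<inter> {p. w (snd p) < w (fst p) \<or> 1 < x (w (fst p)) - x (w (snd p))})"
    by (rule trans[OF sum_of_bool_eq of_nat_id]) (rule finite_pos_roots)+
  also have "pos_roots n \<inter> {p. w (snd p) < w (fst p) \<or> 1 < x (w (fst p)) - x (w (snd p))} =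
      {(i, j) \<in> pos_roots n. w j < w i \<or> 1 < x (w i) - x (w j)}"
    by auto
  finally show ?thesis .
qed

lemma ish_sorted:
  assumes "n \<ge> 1" "sorts n w x" "generic n x"
  shows "ish n (alcove_of n x) = (\<Sum>i=1..n - 1. nat \<lfloor>x (w i) - x (w n)\<rfloor>)"
proof -
  have w: "w permutes {1..n}" using assms(2) by (simp add: sorts_def)
  have gxw: "generic n (x \<circ> w)" by (rule comp_permutes_generic[OF w assms(3)])
  define R where "R = (\<lambda>i. (i, n)) ` {1..n - 1}"
  have R: "R \<subseteq> pos_roots n" using assms(1) by (auto simp: R_def pos_roots_def)
  have "(i, j) \<in> R \<longleftrightarrow> 1 \<le> i \<and> i \<le> n - 1 \<and> j = n" for i j
    by (auto simp: R_def image_iff)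
  then have "{hyperplane n i n a | i a. 1 \<le> i \<and> i \<le> n - 1} =
      {hyperplane n i j a | i j a. (i, j) \<in> R \<and> a \<in> UNIV}"
    by (simp only: UNIV_I) blast
  then have "ish n (alcove_of n x) =
      (\<Sum>(i, j)\<in>R. card {a \<in> UNIV. crosses a ((x \<circ> w) i - (x \<circ> w) j)})"
    unfolding ish_def dominant_translate_alcove_of[OF assms(2,3)]
    by (simp only: card_separating_hyperplanes[OF assms(1) gxw R])
  also have "\<dots> = (\<Sum>(i, j)\<in>R. nat \<lfloor>x (w i) - x (w j)\<rfloor>)"
  proof (intro sum.cong refl)
    fix p assume "p \<in> R"
    moreover obtain i j where p: "p = (i, j)" by (cases p)
    ultimately have ij: "(i, j) \<in> pos_roots n" using R by blast
    have "0 \<le> \<lfloor>x (w i) - x (w j)\<rfloor>" using comp_sorts(2)[OF assms(2,3) ij] by simp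
    then show "(case p of (i, j) \<Rightarrow> card {a \<in> UNIV. crosses a ((x \<circ> w) i - (x \<circ> w) j)}) =
        (case p of (i, j) \<Rightarrow> nat \<lfloor>x (w i) - x (w j)\<rfloor>)"
      using card_crossed_integers[OF comp_sorts(1)[OF assms(2,3) ij]] by (simp add: p)
  qed
  also have "\<dots> = (\<Sum>i=1..n - 1. nat \<lfloor>x (w i) - x (w n)\<rfloor>)"
    unfolding R_def by (subst sum.reindex) (auto simp: inj_on_def)
  finally show ?thesis .
qed

section \<open>Bounce counts of an ideal\<close>

lemma root_ideal_upward:
  assumes "root_ideal n I" "\<alpha> \<in> I" "root_le \<alpha> \<beta>" "\<beta> \<in> pos_roots n"
  shows "\<beta> \<in> I"
  using assms by (simp add: root_ideal_def)

text \<open>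
  The squares of an ideal in row \<open>j\<close> form an initial segment, whose cardinality, the abscissa of
  the vertical step, is its largest element.
\<close>

lemma vertical_step_iff:
  assumes "root_ideal n I"
  shows "(i, j) \<in> I \<longleftrightarrow> 1 \<le> i \<and> i \<le> vertical_step I j"
proof -
  define S where "S = {i. i < j \<and> (i, j) \<in> I}"
  have I: "I \<subseteq> pos_roots n" using assms by (simp add: root_ideal_def)
  then have S: "i \<in> S \<longleftrightarrow> (i, j) \<in> I" for i by (auto simp: S_def pos_roots_def)
  have down: "i' \<in> S" if "i \<in> S" "1 \<le> i'" "i' \<le> i" for i i'
  proof -
    have "(i, j) \<in> I" "(i, j) \<in> pos_roots n" using that I S by auto
    then have "(i', j) \<in> pos_roots n" "root_le (i, j) (i', j)"
      using that by (auto simp: pos_roots_def root_le_def)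
    then have "(i', j) \<in> I" using root_ideal_upward[OF assms \<open>(i, j) \<in> I\<close>] by simp
    then show ?thesis using S by simp
  qed
  have fin: "finite S" by (rule finite_subset[of _ "{..j}"]) (auto simp: S_def)
  have one: "1 \<le> i" if "i \<in> S" for i using that S I by (auto simp: pos_roots_def)
  have "S = {1..card S}"
  proof (cases "S = {}")
    case False
    have "S = {1..Max S}"
    proof (intro set_eqI iffI)
      fix i assume "i \<in> S"
      then show "i \<in> {1..Max S}" using one Max_ge[OF fin] by simp
    next
      fix i assume "i \<in> {1..Max S}"
      then show "i \<in> S" using down[OF Max_in[OF fin False], of i] by simp
    qed
    then show ?thesis by (metis card_atLeastAtMost diff_Suc_1)
  qed simp
  then have "i \<in> S \<longleftrightarrow> 1 \<le> i \<and> i \<le> card S" by (metis atLeastAtMost_iff)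
  then show ?thesis unfolding S by (simp add: vertical_step_def S_def)
qed

lemma vertical_step_less:
  assumes "root_ideal n I" "1 \<le> j"
  shows "vertical_step I j < j"
proof (cases "vertical_step I j = 0")
  case False
  then have "(vertical_step I j, j) \<in> I" using vertical_step_iff[OF assms(1)] by simp
  then show ?thesis using assms(1) by (auto simp: root_ideal_def pos_roots_def)
qed (use assms in simp)

lemma vertical_step_le: "root_ideal n I \<Longrightarrow> vertical_step I j \<le> j"
  using vertical_step_less[of n I j] by (cases "j = 0") (auto simp: vertical_step_def)

lemma vertical_step_mono:
  assumes "root_ideal n I" "j \<le> l" "l \<le> n"
  shows "vertical_step I j \<le> vertical_step I l"
proof (cases "vertical_step I j = 0")
  case False
  then have I: "(vertical_step I j, j) \<in> I" using vertical_step_iff[OF assms(1)] by simp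
  then have "(vertical_step I j, l) \<in> pos_roots n"
      "root_le (vertical_step I j, j) (vertical_step I j, l)"
    using assms by (auto simp: root_ideal_def pos_roots_def root_le_def)
  then have "(vertical_step I j, l) \<in> I" using root_ideal_upward[OF assms(1) I] by simp
  then show ?thesis using vertical_step_iff[OF assms(1)] by simp
qed simp

text \<open>
  The number of bounces that can be made from \<open>j\<close> without passing to the left of \<open>i\<close>. It equals
  the largest length of a chain of consecutive, non-overlapping roots of the ideal between \<open>i\<close>
  and \<open>j\<close>, since bouncing chooses such a chain greedily. It is the smallest possible floor of
  $x_i - x_j$ for a dominant point on which all roots of the ideal exceed 1.
\<close>

definition bounce_count :: "(nat \<times> nat) set \<Rightarrow> nat \<Rightarrow> nat \<Rightarrow> nat" where
  "bounce_count I i j = card {r. 0 < r \<and> i \<le> (vertical_step I ^^ r) j}"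

lemma funpow_vertical_step_le:
  assumes "root_ideal n I"
  shows "(vertical_step I ^^ r) j \<le> j - r"
proof (induction r)
  case (Suc r)
  have "vertical_step I m \<le> m - 1" for m
    using vertical_step_less[OF assms, of m] vertical_step_le[OF assms, of m]
    by (cases "m = 0") auto
  from this[of "(vertical_step I ^^ r) j"] show ?case using Suc by simp
qed simp

lemma bounce_count_rec:
  assumes "root_ideal n I" "1 \<le> i"
  shows "bounce_count I i j =
    (if i \<le> vertical_step I j then Suc (bounce_count I i (vertical_step I j)) else 0)"
proof -
  let ?v = "vertical_step I"
  define B where "B = (\<lambda>j. {r. 0 < r \<and> i \<le> (?v ^^ r) j})"
  have fin: "finite (B j)" for j
  proof (rule finite_subset)
    show "B j \<subseteq> {..j}"
    proof
      fix r assume "r \<in> B j"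
      then have "1 \<le> j - r" using funpow_vertical_step_le[OF assms(1), of r j] assms(2) by (simp add: B_def)
      then show "r \<in> {..j}" by simp
    qed
  qed simp
  have le: "(?v ^^ r) j \<le> j" for r j using funpow_vertical_step_le[OF assms(1), of r j] by simp
  show ?thesis
  proof (cases "i \<le> ?v j")
    case True
    have "B j = Suc ` insert 0 (B (?v j))"
    proof (intro set_eqI)
      fix r
      show "r \<in> B j \<longleftrightarrow> r \<in> Suc ` insert 0 (B (?v j))"
      proof (cases r)
        case 0
        then show ?thesis by (simp add: B_def)
      next
        case (Suc s)
        have "(?v ^^ r) j = (?v ^^ s) (?v j)" by (simp add: Suc funpow_swap1)
        then have "r \<in> B j \<longleftrightarrow> i \<le> (?v ^^ s) (?v j)" by (simp add: B_def Suc del: funpow.simps)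
        also have "\<dots> \<longleftrightarrow> s \<in> insert 0 (B (?v j))" using True by (cases s) (simp_all add: B_def)
        also have "\<dots> \<longleftrightarrow> r \<in> Suc ` insert 0 (B (?v j))"
          unfolding Suc by (rule inj_image_mem_iff[OF inj_Suc, symmetric])
        finally show ?thesis .
      qed
    qed
    then have "card (B j) = card (Suc ` insert 0 (B (?v j)))" by (rule arg_cong)
    also have "\<dots> = card (insert 0 (B (?v j)))" by (rule card_image, rule inj_onI) simp
    also have "\<dots> = Suc (card (B (?v j)))"
      using fin by (rule card_insert_disjoint) (simp add: B_def)
    finally have "card (B j) = Suc (card (B (?v j)))" .
    then show ?thesis using True by (simp add: bounce_count_def B_def)
  next
    case False
    have "B j = {}"
    proof -
      have "\<not> i \<le> (?v ^^ r) j" if r: "0 < r" for r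
      proof -
        obtain s where "r = Suc s" using r by (cases r) auto
        then have "(?v ^^ r) j = (?v ^^ s) (?v j)" by (simp add: funpow_swap1)
        also have "\<dots> \<le> ?v j" by (rule le)
        finally show ?thesis using False by linarith
      qed
      then show ?thesis unfolding B_def by blast
    qed
    then have "card (B j) = 0" by (simp only: card.empty)
    then show ?thesis using False by (simp add: bounce_count_def B_def)
  qed
qed

lemma bounce_count_pos_iff:
  assumes "root_ideal n I" "1 \<le> i"
  shows "1 \<le> bounce_count I i j \<longleftrightarrow> (i, j) \<in> I"
  using bounce_count_rec[OF assms, of j] vertical_step_iff[OF assms(1), of i j] assms(2) by auto

lemma bounce_count_mono:
  assumes "root_ideal n I" "1 \<le> i" "j \<le> l" "l \<le> n"
  shows "bounce_count I i j \<le> bounce_count I i l"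
  using assms(3,4)
proof (induction l arbitrary: j rule: less_induct)
  case (less l)
  let ?v = "vertical_step I"
  show ?case
  proof (cases "i \<le> ?v j")
    case True
    have "?v j \<le> ?v l" using vertical_step_mono[OF assms(1) less.prems] .
    moreover have "?v l < l" using vertical_step_less[OF assms(1), of l] True less.prems
        vertical_step_le[OF assms(1), of j] assms(2) by simp
    ultimately have "bounce_count I i (?v j) \<le> bounce_count I i (?v l)"
      using less.IH less.prems by simp
    then show ?thesis
      using True \<open>?v j \<le> ?v l\<close> bounce_count_rec[OF assms(1,2), of j]
        bounce_count_rec[OF assms(1,2), of l] by simp
  next
    case False
    then show ?thesis using bounce_count_rec[OF assms(1,2), of j] by simp
  qed
qed

text \<open>
  Bounces from \<open>l\<close> that do not pass \<open>j\<close> can be continued from a point at or to the right of \<open>j\<close>,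
  and starting further right never loses bounces.
\<close>

lemma bounce_count_super_additive:
  assumes "root_ideal n I" "1 \<le> i" "i \<le> j" "j \<le> l" "l \<le> n"
  shows "bounce_count I i j + bounce_count I j l \<le> bounce_count I i l"
  using assms(4,5)
proof (induction l rule: less_induct)
  case (less l)
  let ?v = "vertical_step I"
  have j: "1 \<le> j" using assms by simp
  show ?case
  proof (cases "j \<le> ?v l")
    case True
    have "?v l < l" using vertical_step_less[OF assms(1), of l] less.prems j by simp
    then have "bounce_count I i j + bounce_count I j (?v l) \<le> bounce_count I i (?v l)"
      using less True by simp
    then show ?thesis
      using True assms(3) bounce_count_rec[OF assms(1,2), of l] bounce_count_rec[OF assms(1) j, of l]
      by simp
  next
    case False
    then show ?thesis
      using bounce_count_rec[OF assms(1) j, of l] bounce_count_mono[OF assms(1,2) less.prems] by simp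
  qed
qed

text \<open>
  One bounce from \<open>l\<close> may straddle \<open>j\<close>; the bounces before it are counted between \<open>j\<close> and \<open>l\<close>,
  and those after it start to the left of \<open>j\<close>, so they are no more than those from \<open>j\<close>.
\<close>

lemma bounce_count_quasi_sub_additive:
  assumes "root_ideal n I" "1 \<le> i" "i \<le> j" "j \<le> l" "l \<le> n"
  shows "bounce_count I i l \<le> bounce_count I i j + bounce_count I j l + 1"
  using assms(4,5)
proof (induction l rule: less_induct)
  case (less l)
  let ?v = "vertical_step I"
  have j: "1 \<le> j" using assms by simp
  show ?case
  proof (cases "j \<le> ?v l")
    case True
    have "?v l < l" using vertical_step_less[OF assms(1), of l] less.prems j by simp
    then have "bounce_count I i (?v l) \<le> bounce_count I i j + bounce_count I j (?v l) + 1"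
      using less True by simp
    then show ?thesis
      using True assms(3) bounce_count_rec[OF assms(1,2), of l] bounce_count_rec[OF assms(1) j, of l]
      by simp
  next
    case False
    then have "bounce_count I i (?v l) \<le> bounce_count I i j"
      using bounce_count_mono[OF assms(1,2), of "?v l" j] less.prems by simp
    then show ?thesis using bounce_count_rec[OF assms(1,2), of l] by simp
  qed
qed

text \<open>
  Each bounce is along a root of the ideal, hence costs more than 1, and the remaining pieces have
  nonnegative length because \<open>u\<close> is decreasing.
\<close>

lemma bounce_count_lower_bound:
  fixes u :: "nat \<Rightarrow> real"
  assumes I: "root_ideal n I"
    and dec: "\<forall>(i, j)\<in>pos_roots n. u j < u i"
    and gap: "\<forall>(i, j)\<in>I. 1 < u i - u j"
    and "(i, j) \<in> pos_roots n"
  shows "bounce_count I i j < u i - u j"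
proof -
  let ?v = "vertical_step I"
  have i: "1 \<le> i" and ij: "i < j" "j \<le> n" using assms(4) by (auto simp: pos_roots_def)
  have "bounce_count I i j \<le> u i - u j \<and> (i < j \<longrightarrow> bounce_count I i j < u i - u j)"
    if "i \<le> j" "j \<le> n" for j
    using that
  proof (induction j rule: less_induct)
    case (less j)
    show ?case
    proof (cases "i \<le> ?v j")
      case True
      then have "(?v j, j) \<in> I" using vertical_step_iff[OF I] i by simp
      then have "1 < u (?v j) - u j" using gap by blast
      moreover have "bounce_count I i (?v j) \<le> u i - u (?v j)"
        using less.IH[of "?v j"] True vertical_step_less[OF I, of j] less.prems i by simp
      ultimately show ?thesis using bounce_count_rec[OF I i, of j] True by simp
    next
      case False
      then have 0: "bounce_count I i j = 0" using bounce_count_rec[OF I i, of j] by simp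
      have "u j < u i" if "i < j" using dec that i less.prems by (auto simp: pos_roots_def)
      then show ?thesis using 0 less.prems by (cases "i = j") auto
    qed
  qed
  then show ?thesis using ij by simp
qed

lemma bounce_points_le:
  assumes "root_ideal n I" "i \<in> bounce_points m I"
  shows "i \<le> m"
  using assms(2)
proof induction
  case (bounce p)
  then show ?case using vertical_step_less[OF assms(1), of p] by simp
qed simp

lemma bounce_points_rec:
  assumes "1 \<le> m"
  shows "bounce_points m I = insert m (bounce_points (vertical_step I m) I)"
proof
  show "bounce_points m I \<subseteq> insert m (bounce_points (vertical_step I m) I)"
  proof
    fix i assume "i \<in> bounce_points m I"
    then show "i \<in> insert m (bounce_points (vertical_step I m) I)"
      by induction (auto intro: bounce_points.intros)
  qed
  show "insert m (bounce_points (vertical_step I m) I) \<subseteq> bounce_points m I"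
  proof
    fix i assume i: "i \<in> insert m (bounce_points (vertical_step I m) I)"
    have "i \<in> bounce_points m I" if "i \<in> bounce_points (vertical_step I m) I"
      using that by induction (auto intro: bounce_points.intros assms)
    then show "i \<in> bounce_points m I" using i by (auto intro: bounce_points.intros)
  qed
qed

text \<open>
  The first bounce leads from \<open>m\<close> to \<open>vertical_step I m\<close>, and the path continues as the bounce path
  that starts there. The starting point of a bounce path does not contribute to \<open>bounce\<close>, so the
  end of the first bounce is added separately; if it is 0, it contributes nothing.
\<close>

lemma bounce_rec:
  assumes "root_ideal n I" "1 \<le> m"
  shows "bounce m I = vertical_step I m + bounce (vertical_step I m) I"
proof -
  define v where "v = vertical_step I m"
  have v: "v < m" using vertical_step_less[OF assms] by (simp add: v_def)
  have le: "i \<le> v" if "i \<in> bounce_points v I" for i using bounce_points_le[OF assms(1) that] .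
  have "v \<in> bounce_points v I" by (rule bounce_points.start)
  then have "{i \<in> {1..m - 1}. i \<in> bounce_points m I} =
      (if v = 0 then {} else insert v {i \<in> {1..v - 1}. i \<in> bounce_points v I})"
    using v le unfolding bounce_points_rec[OF assms(2)] v_def[symmetric]
    by (auto simp: le_less) fastforce+
  moreover have "v \<notin> {i \<in> {1..v - 1}. i \<in> bounce_points v I}" if "v \<noteq> 0" using that by auto
  ultimately have "bounce m I = v + bounce v I" by (simp add: bounce_def)
  then show ?thesis by (simp add: v_def)
qed

text \<open>
  Double counting: a diagonal point $(p,p)$ with $p < m$ on the bounce path from \<open>m\<close>
  contributes one bounce to each of the \<open>p\<close> indices $i \le p$, and \<open>p\<close> to the bounce
  statistic.
\<close>

lemma sum_bounce_count:
  assumes "root_ideal n I"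
  shows "(\<Sum>i=1..m - 1. bounce_count I i m) = bounce m I"
proof (induction m rule: less_induct)
  case (less m)
  show ?case
  proof (cases "m = 0")
    case True
    then show ?thesis by (simp add: bounce_def)
  next
    case False
    define v where "v = vertical_step I m"
    have v: "v < m" using vertical_step_less[OF assms, of m] False by (simp add: v_def)
    have "(\<Sum>i=1..m - 1. bounce_count I i m) = (\<Sum>i=1..v. Suc (bounce_count I i v))"
    proof (rule sum.mono_neutral_cong_right)
      show "{1..v} \<subseteq> {1..m - 1}" using v by auto
      show "\<forall>i\<in>{1..m - 1} - {1..v}. bounce_count I i m = 0"
        using bounce_count_rec[OF assms, of _ m] by (auto simp: v_def)
      show "bounce_count I i m = Suc (bounce_count I i v)" if "i \<in> {1..v}" for i
        using bounce_count_rec[OF assms, of i m] that by (simp add: v_def)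
    qed simp
    also have "\<dots> = v + (\<Sum>i=1..v. bounce_count I i v)"
      by (simp add: sum_Suc)
    also have "(\<Sum>i=1..v. bounce_count I i v) = (\<Sum>i=1..v - 1. bounce_count I i v)"
    proof (cases "v = 0")
      case False
      then have "bounce_count I v v = 0"
        using bounce_count_rec[OF assms, of v v] vertical_step_less[OF assms, of v] by simp
      moreover have "{1..v} = insert v {1..v - 1}" using False by auto
      ultimately show ?thesis using False by simp
    qed simp
    also have "\<dots> = bounce v I" using less v by simp
    finally show ?thesis using bounce_rec[OF assms, of m] False by (simp add: v_def)
  qed
qed

section \<open>Points with prescribed floors\<close>

lemma ex_real_between:
  fixes A B :: "real set"
  assumes "finite A" "finite B" "\<And>a b. a \<in> A \<Longrightarrow> b \<in> B \<Longrightarrow> a < b"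
  shows "\<exists>t. (\<forall>a\<in>A. a < t) \<and> (\<forall>b\<in>B. t < b)"
proof (cases "A = {} \<or> B = {}")
  case True
  obtain s t where "\<forall>a\<in>A. a < s" "\<forall>b\<in>B. t < b"
    using assms finite_less_ub
    by (metis bdd_above_finite bdd_below_finite bdd_above.unfold bdd_below.unfold gt_ex lt_ex le_less_trans less_le_trans)
  then show ?thesis using True by blast
next
  case False
  then have "Max A < Min B" using assms by simp
  then obtain t where "Max A < t" "t < Min B" using dense by blast
  then show ?thesis using assms False by (intro exI[of _ t]) auto
qed

text \<open>
  Shi's criterion for a family of integers to be the floors of the coordinate differences of a
  point. Coordinates are chosen one after the other: the new one has to lie in finitely many open
  intervals, one for each previous coordinate, and the two inequalities between the integers say
  that these intervals meet pairwise. On the line this suffices.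
\<close>

lemma ex_point_with_floors:
  fixes k :: "nat \<Rightarrow> nat \<Rightarrow> int"
  assumes "\<And>i j l. 1 \<le> i \<Longrightarrow> i < j \<Longrightarrow> j < l \<Longrightarrow> l \<le> n \<Longrightarrow>
    k i j + k j l \<le> k i l \<and> k i l \<le> k i j + k j l + 1"
  shows "\<exists>y :: nat \<Rightarrow> real. \<forall>(i, j)\<in>pos_roots n. k i j < y i - y j \<and> y i - y j < k i j + 1"
  using assms
proof (induction n)
  case 0
  then show ?case by (auto simp: pos_roots_def)
next
  case (Suc n)
  have "\<exists>y :: nat \<Rightarrow> real. \<forall>(i, j)\<in>pos_roots n. k i j < y i - y j \<and> y i - y j < k i j + 1"
    using Suc.prems by (intro Suc.IH) simp
  then obtain y :: "nat \<Rightarrow> real" where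
    y: "\<And>i j. (i, j) \<in> pos_roots n \<Longrightarrow> k i j < y i - y j \<and> y i - y j < k i j + 1" by blast
  define L where "L = (\<lambda>i. y i - k i (Suc n) - 1) ` {1..n}"
  define U where "U = (\<lambda>i. y i - k i (Suc n)) ` {1..n}"
  \<comment> \<open>Superadditivity is used for $i < j$, quasi-subadditivity for $j < i$.\<close>
  have LU: "y i - k i (Suc n) - 1 < y j - k j (Suc n)" if "i \<in> {1..n}" "j \<in> {1..n}" for i j
  proof (cases i j rule: linorder_cases)
    case less
    then have "k i j + k j (Suc n) \<le> k i (Suc n)" using Suc.prems that by simp
    then have "real_of_int (k i j) + k j (Suc n) \<le> k i (Suc n)" by (simp flip: of_int_add)
    moreover have "y i - y j < k i j + 1" using y[of i j] that less by (simp add: pos_roots_def)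
    ultimately show ?thesis by simp
  next
    case greater
    then have "k j (Suc n) \<le> k j i + k i (Suc n) + 1" using Suc.prems that by simp
    then have "real_of_int (k j (Suc n)) \<le> k j i + k i (Suc n) + 1"
      by (metis of_int_1 of_int_add of_int_le_iff)
    moreover have "k j i < y j - y i" using y[of j i] that greater by (simp add: pos_roots_def)
    ultimately show ?thesis by simp
  qed simp
  have "\<exists>t. (\<forall>a\<in>L. a < t) \<and> (\<forall>b\<in>U. t < b)"
    by (rule ex_real_between) (use LU in \<open>auto simp: L_def U_def\<close>)
  then obtain t where "\<forall>a\<in>L. a < t" "\<forall>b\<in>U. t < b" by blast
  then have t: "y i - k i (Suc n) - 1 < t \<and> t < y i - k i (Suc n)" if "i \<in> {1..n}" for i
    using that by (simp add: L_def U_def)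
  have "k i j < (y(Suc n := t)) i - (y(Suc n := t)) j \<and>
      (y(Suc n := t)) i - (y(Suc n := t)) j < k i j + 1" if ij: "(i, j) \<in> pos_roots (Suc n)" for i j
  proof (cases "j = Suc n")
    case True
    then have "i \<in> {1..n}" using ij by (auto simp: pos_roots_def)
    from t[OF this] show ?thesis using True \<open>i \<in> {1..n}\<close> by simp
  next
    case False
    then have "(i, j) \<in> pos_roots n" "i \<noteq> Suc n" using ij by (auto simp: pos_roots_def)
    then show ?thesis using y[of i j] False by simp
  qed
  then show ?case by blast
qed

section \<open>The shortest alcove of a Shi region\<close>

text \<open>
  A point in the alcove attached to the labelled Dyck path \<open>(w, I)\<close>: sorted by \<open>w\<close>, and with all
  floors as small as the ideal permits.
\<close>

definition path_point ::
    "nat \<Rightarrow> (nat \<Rightarrow> nat) \<Rightarrow> (nat \<times> nat) set \<Rightarrow> (nat \<Rightarrow> real) \<Rightarrow> bool" where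
  "path_point n w I x \<longleftrightarrow> generic n x \<and> sorts n w x \<and>
    (\<forall>(i, j)\<in>pos_roots n. \<lfloor>x (w i) - x (w j)\<rfloor> = int (bounce_count I i j))"

lemma path_pointD:
  assumes "path_point n w I x"
  shows "generic n x" "sorts n w x"
    and "(i, j) \<in> pos_roots n \<Longrightarrow> \<lfloor>x (w i) - x (w j)\<rfloor> = int (bounce_count I i j)"
  using assms by (auto simp: path_point_def)

lemma path_point_exists:
  assumes "n \<ge> 1" "w permutes {1..n}" "root_ideal n I"
  shows "\<exists>x. path_point n w I x"
proof -
  let ?k = "\<lambda>i j. int (bounce_count I i j)"
  have "?k i j + ?k j l \<le> ?k i l \<and> ?k i l \<le> ?k i j + ?k j l + 1"
    if "1 \<le> i" "i < j" "j < l" "l \<le> n" for i j l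
    using bounce_count_super_additive[OF assms(3), of i j l]
      bounce_count_quasi_sub_additive[OF assms(3), of i j l] that by simp
  from ex_point_with_floors[of n ?k, OF this] obtain u :: "nat \<Rightarrow> real" where
    u: "\<And>i j. (i, j) \<in> pos_roots n \<Longrightarrow> ?k i j < u i - u j \<and> u i - u j < ?k i j + 1"
    by blast
  obtain y where y: "y \<in> quot_space n" "\<forall>i\<in>{1..n}. \<forall>j\<in>{1..n}. y i - y j = u i - u j"
    using ex_quot_space_differences[OF assms(1), of u] by blast
  have yu: "y i - y j = u i - u j" if "(i, j) \<in> pos_roots n" for i j
    using y(2) that by (simp add: pos_roots_def)
  have fl: "\<lfloor>y i - y j\<rfloor> = ?k i j" if "(i, j) \<in> pos_roots n" for i j
    using u[OF that] unfolding yu[OF that] by (intro floor_unique) simp_all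
  have nonint: "y i - y j \<notin> \<int>" if "(i, j) \<in> pos_roots n" for i j
  proof
    assume "y i - y j \<in> \<int>"
    then obtain a where a: "y i - y j = of_int a" by (rule Ints_cases)
    have "a = ?k i j" using fl[OF that] unfolding a floor_of_int .
    then have "u i - u j = real_of_int (?k i j)" using a yu[OF that] by (simp only:)
    then show False using u[OF that] by simp
  qed
  define x where "x = y \<circ> inv w"
  have xw: "x (w i) = y i" for i
    using permutes_inverses(2)[OF assms(2)] by (simp add: x_def)
  have "generic n y" using y(1) nonint by (auto simp: generic_iff)
  then have "generic n x"
    unfolding x_def by (rule comp_permutes_generic[OF permutes_inv[OF assms(2)]])
  moreover have "y j < y i" if "(i, j) \<in> pos_roots n" for i j
    using u[OF that] yu[OF that] by linarith
  then have "sorts n w x" using assms(2) by (auto simp: sorts_def xw)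
  ultimately have "path_point n w I x" using fl by (auto simp: path_point_def xw)
  then show ?thesis by blast
qed

text \<open>
  The labelling condition speaks of minimal roots; by this lemma they control the whole ideal.
  Passing to a smaller root shortens it, so the descent ends.
\<close>

lemma minimal_root_below:
  assumes "I \<subseteq> pos_roots n" "\<alpha> \<in> I"
  shows "\<exists>\<mu>\<in>minimal_roots I. root_le \<mu> \<alpha>"
  using assms(2)
proof (induction "snd \<alpha> - fst \<alpha>" arbitrary: \<alpha> rule: less_induct)
  case less
  show ?case
  proof (cases "\<alpha> \<in> minimal_roots I")
    case True
    then show ?thesis by (intro bexI[of _ \<alpha>]) (simp_all add: root_le_def)
  next
    case False
    then obtain \<beta> where \<beta>: "\<beta> \<in> I" "root_le \<beta> \<alpha>" "\<beta> \<noteq> \<alpha>"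
      using less.prems by (auto simp: minimal_roots_def)
    then have "fst \<alpha> < snd \<alpha>" "fst \<beta> < snd \<beta>" using less.prems assms(1) by (auto simp: pos_roots_def)
    then have "snd \<beta> - fst \<beta> < snd \<alpha> - fst \<alpha>"
      using \<beta>(2,3) by (auto simp: root_le_def prod_eq_iff)
    then obtain \<mu> where \<mu>: "\<mu> \<in> minimal_roots I" "root_le \<mu> \<beta>" using less.hyps \<beta>(1) by blast
    have "root_le \<mu> \<alpha>" using \<mu>(2) \<beta>(2) by (simp add: root_le_def)
    then show ?thesis using \<mu>(1) by blast
  qed
qed

lemma sorts_diff_mono:
  assumes "sorts n w z" "(i, j) \<in> pos_roots n" "(a, b) \<in> pos_roots n" "root_le (a, b) (i, j)"
  shows "z (w a) - z (w b) \<le> z (w i) - z (w j)"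
proof -
  have dec: "z (w q) \<le> z (w p)" if "1 \<le> p" "p \<le> q" "q \<le> n" for p q
  proof (cases "p = q")
    case False
    then have "(p, q) \<in> pos_roots n" using that by (simp add: pos_roots_def)
    then show ?thesis using assms(1) by (auto simp: sorts_def)
  qed simp
  have "z (w a) \<le> z (w i)" "z (w j) \<le> z (w b)"
    using assms(2-4) by (auto intro!: dec simp: pos_roots_def root_le_def)
  then show ?thesis by simp
qed

lemma path_point_gt_one_iff:
  assumes "root_ideal n I" "path_point n w I x" "(i, j) \<in> pos_roots n"
  shows "1 < x (w i) - x (w j) \<longleftrightarrow> (i, j) \<in> I"
proof -
  have gs: "sorts n w x" "generic n x" using assms(2) by (auto simp: path_point_def)
  have "1 < x (w i) - x (w j) \<longleftrightarrow> 1 \<le> \<lfloor>x (w i) - x (w j)\<rfloor>"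
    by (rule pos_iff_floor_nonneg(2)[OF comp_sorts(1)[OF gs assms(3)]])
  also have "\<lfloor>x (w i) - x (w j)\<rfloor> = int (bounce_count I i j)"
    using assms(2,3) by (auto simp: path_point_def)
  also have "1 \<le> int (bounce_count I i j) \<longleftrightarrow> 1 \<le> bounce_count I i j" by simp
  also have "\<dots> \<longleftrightarrow> (i, j) \<in> I"
    using assms(3) by (intro bounce_count_pos_iff[OF assms(1)]) (simp add: pos_roots_def)
  finally show ?thesis .
qed

lemma same_shi_regionD:
  assumes "same_shi_region n x y" "(i, j) \<in> pos_roots n"
  shows "x i - x j < 0 \<longleftrightarrow> y i - y j < 0" "x i - x j < 1 \<longleftrightarrow> y i - y j < 1"
  using bspec[OF assms[unfolded same_shi_region_def]] by simp_all

text \<open>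
  The Shi region of a point records the sorting permutation and, at non-inversions only, whether a
  difference exceeds 1. Since the minimal roots of \<open>I\<close> are non-inversions, it follows that all of
  \<open>I\<close> exceeds 1 throughout the region, and the bounce counts bound the floors from below.
\<close>

lemma floors_ge_path_point:
  assumes lab: "(w, I) \<in> labeled_dyck_paths n" and x: "path_point n w I x"
    and z: "generic n z" and same: "same_shi_region n x z"
  shows "sorts n w z"
    and "(i, j) \<in> pos_roots n \<Longrightarrow> int (bounce_count I i j) \<le> \<lfloor>z (w i) - z (w j)\<rfloor>"
proof -
  have w: "w permutes {1..n}" and I: "root_ideal n I" and minim: "minimal_roots I \<subseteq> non_inversions n w"
    using lab by (auto simp: labeled_dyck_paths_def)
  have gs: "sorts n w x" "generic n x" using x by (auto simp: path_point_def)
  have nonint: "z (w i) - z (w j) \<notin> \<int>" if "(i, j) \<in> pos_roots n" for i j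
  proof -
    have "(z \<circ> w) i - (z \<circ> w) j \<notin> \<int>"
      using comp_permutes_generic[OF w z] that unfolding generic_iff by blast
    then show ?thesis by simp
  qed
  have "z (w j) < z (w i)" if ij: "(i, j) \<in> pos_roots n" for i j
  proof -
    have ne: "z (w i) \<noteq> z (w j)" using nonint[OF ij] by auto
    have mem: "w i \<in> {1..n}" "w j \<in> {1..n}"
      using ij permutes_in_image[OF w] by (auto simp: pos_roots_def)
    have pos: "0 < x (w i) - x (w j)" by (rule comp_sorts(2)[OF gs ij])
    show ?thesis
    proof (cases "w i < w j")
      case True
      then have "(w i, w j) \<in> pos_roots n" using mem by (simp add: pos_roots_def)
      from same_shi_regionD(1)[OF same this] pos have "\<not> z (w i) - z (w j) < 0" by linarith
      then show ?thesis using ne by simp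
    next
      case False
      moreover have "w i \<noteq> w j" using ne by auto
      ultimately have "(w j, w i) \<in> pos_roots n" using mem by (simp add: pos_roots_def)
      from same_shi_regionD(1)[OF same this] pos have "z (w j) - z (w i) < 0" by linarith
      then show ?thesis by simp
    qed
  qed
  then show sz: "sorts n w z" using w by (auto simp: sorts_def)
  have gap: "1 < z (w i) - z (w j)" if ij: "(i, j) \<in> I" for i j
  proof -
    have sub: "I \<subseteq> pos_roots n" using I by (simp add: root_ideal_def)
    obtain a b where ab: "(a, b) \<in> minimal_roots I" "root_le (a, b) (i, j)"
      using minimal_root_below[OF sub ij] by auto
    then have abI: "(a, b) \<in> I" "(a, b) \<in> pos_roots n" "w a < w b"
      using minim sub by (auto simp: minimal_roots_def non_inversions_def)
    have "(w a, w b) \<in> pos_roots n"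
    proof -
      have "a \<in> {1..n}" "b \<in> {1..n}" using abI(2) by (auto simp: pos_roots_def)
      then have "w a \<in> {1..n}" "w b \<in> {1..n}" by (simp_all only: permutes_in_image[OF w])
      then show ?thesis using abI(3) by (simp add: pos_roots_def)
    qed
    then have "x (w a) - x (w b) < 1 \<longleftrightarrow> z (w a) - z (w b) < 1"
      by (rule same_shi_regionD(2)[OF same])
    moreover have "1 < x (w a) - x (w b)" using path_point_gt_one_iff[OF I x abI(2)] abI(1) by simp
    ultimately have "\<not> z (w a) - z (w b) < 1" by simp
    moreover have "z (w a) - z (w b) \<noteq> 1" using nonint[OF abI(2)] by auto
    ultimately have "1 < z (w a) - z (w b)" by simp
    also have "\<dots> \<le> z (w i) - z (w j)"
      using sorts_diff_mono[OF sz _ abI(2) ab(2)] ij sub by blast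
    finally show ?thesis .
  qed
  assume ij: "(i, j) \<in> pos_roots n"
  have "real (bounce_count I i j) < (z \<circ> w) i - (z \<circ> w) j"
  proof (rule bounce_count_lower_bound[OF I _ _ ij])
    show "\<forall>(i, j)\<in>pos_roots n. (z \<circ> w) j < (z \<circ> w) i" using sz by (simp add: sorts_def)
    show "\<forall>(i, j)\<in>I. 1 < (z \<circ> w) i - (z \<circ> w) j" using gap by auto
  qed
  then show "int (bounce_count I i j) \<le> \<lfloor>z (w i) - z (w j)\<rfloor>" by (simp add: le_floor_iff)
qed

lemma permutes_preimage:
  assumes "w permutes S" "p \<in> S"
  shows "\<exists>i\<in>S. p = w i"
  using assms unfolding image_iff[symmetric] by (simp add: permutes_image)

lemma alcove_of_eqI:
  assumes "sorts n w x" "generic n x" "sorts n w z" "generic n z"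
    and "\<And>i j. (i, j) \<in> pos_roots n \<Longrightarrow> \<lfloor>x (w i) - x (w j)\<rfloor> = \<lfloor>z (w i) - z (w j)\<rfloor>"
  shows "alcove_of n x = alcove_of n z"
proof -
  have w: "w permutes {1..n}" using assms(1) by (simp add: sorts_def)
  have "\<lfloor>x p - x q\<rfloor> = \<lfloor>z p - z q\<rfloor>" if pq: "p \<in> {1..n}" "q \<in> {1..n}" for p q
  proof -
    obtain i j where ij: "i \<in> {1..n}" "p = w i" "j \<in> {1..n}" "q = w j"
      using permutes_preimage[OF w pq(1)] permutes_preimage[OF w pq(2)] by blast
    have "\<lfloor>(x \<circ> w) i - (x \<circ> w) j\<rfloor> = \<lfloor>(z \<circ> w) i - (z \<circ> w) j\<rfloor>"
    proof (rule floor_eq_all_pairs[OF _ _ _ ij(1,3)])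
      show "generic n (x \<circ> w)" "generic n (z \<circ> w)"
        by (rule comp_permutes_generic[OF w assms(2)], rule comp_permutes_generic[OF w assms(4)])
      show "\<forall>(i, j)\<in>pos_roots n. \<lfloor>(x \<circ> w) i - (x \<circ> w) j\<rfloor> = \<lfloor>(z \<circ> w) i - (z \<circ> w) j\<rfloor>"
        using assms(5) by auto
    qed
    then show ?thesis using ij by simp
  qed
  then show ?thesis unfolding alcove_of_def by (intro Collect_cong) auto
qed

text \<open>
  For a fixed sorting permutation the length is the sum of the floors up to a constant. As the
  path point attains every lower bound at once, its alcove is shortest, and equality of lengths
  forces equality of all floors.
\<close>

lemma path_point_alcove_shortest:
  assumes "n \<ge> 1" and lab: "(w, I) \<in> labeled_dyck_paths n" and x: "path_point n w I x"
    and z: "generic n z" and same: "same_shi_region n x z"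
  shows "alcove_length n (alcove_of n x) \<le> alcove_length n (alcove_of n z)"
    and "alcove_length n (alcove_of n z) \<le> alcove_length n (alcove_of n x) \<Longrightarrow>
      alcove_of n z = alcove_of n x"
proof -
  have sx: "sorts n w x" "generic n x" using x by (auto simp: path_point_def)
  have sz: "sorts n w z" by (rule floors_ge_path_point(1)[OF lab x z same])
  define F where "F = (\<lambda>u :: nat \<Rightarrow> real. \<lambda>p. nat \<lfloor>u (w (fst p)) - u (w (snd p))\<rfloor> + of_bool (w (snd p) < w (fst p)))"
  have len: "alcove_length n (alcove_of n x) = sum (F x) (pos_roots n)"
    "alcove_length n (alcove_of n z) = sum (F z) (pos_roots n)"
    unfolding alcove_length_sorted[OF assms(1) sx] alcove_length_sorted[OF assms(1) sz z]
    by (simp_all add: F_def split_beta)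
  have floor_x: "\<lfloor>x (w i) - x (w j)\<rfloor> = int (bounce_count I i j)" if "(i, j) \<in> pos_roots n" for i j
    using x that by (auto simp: path_point_def)
  have le: "\<lfloor>x (w i) - x (w j)\<rfloor> \<le> \<lfloor>z (w i) - z (w j)\<rfloor>" if "(i, j) \<in> pos_roots n" for i j
    unfolding floor_x[OF that] by (rule floors_ge_path_point(2)[OF lab x z same that])
  have F_le: "F x p \<le> F z p" if "p \<in> pos_roots n" for p
    using le[of "fst p" "snd p"] that by (simp add: F_def nat_mono)
  then show "alcove_length n (alcove_of n x) \<le> alcove_length n (alcove_of n z)"
    unfolding len by (rule sum_mono)
  assume "alcove_length n (alcove_of n z) \<le> alcove_length n (alcove_of n x)"
  then have eq: "sum (F x) (pos_roots n) = sum (F z) (pos_roots n)"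
    using sum_mono[of "pos_roots n" "F x" "F z", OF F_le] unfolding len by simp
  have "\<lfloor>z (w i) - z (w j)\<rfloor> = \<lfloor>x (w i) - x (w j)\<rfloor>" if ij: "(i, j) \<in> pos_roots n" for i j
  proof -
    have "F x (i, j) = F z (i, j)"
      by (rule sum_mono_inv[OF eq F_le ij finite_pos_roots])
    then have "nat \<lfloor>x (w i) - x (w j)\<rfloor> = nat \<lfloor>z (w i) - z (w j)\<rfloor>" by (simp add: F_def)
    moreover have "0 \<le> \<lfloor>x (w i) - x (w j)\<rfloor>" using floor_x[OF ij] by simp
    ultimately show ?thesis using le[OF ij] by (metis eq_nat_nat_iff order_trans)
  qed
  then show "alcove_of n z = alcove_of n x" by (rule alcove_of_eqI[OF sz z sx])
qed

text \<open>
  Every Shi region comes from a labelled path: let \<open>I\<close> be generated by the non-inversions whose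
  difference exceeds 1. Differences grow along the root order, so \<open>I\<close> contains no other
  non-inversions, and a path point for \<open>I\<close> lies in the same region.
\<close>

lemma path_point_in_Shi_region:
  assumes "n \<ge> 1" "generic n z"
  shows "\<exists>w I x. (w, I) \<in> labeled_dyck_paths n \<and> path_point n w I x \<and> same_shi_region n x z"
proof -
  obtain w where sz: "sorts n w z" using sorts_exists[OF assms(2)] by blast
  then have w: "w permutes {1..n}" by (simp add: sorts_def)
  define J where "J = {(i, j) \<in> non_inversions n w. 1 < z (w i) - z (w j)}"
  \<comment> \<open>The minimal roots of the generated ideal lie in \<open>J\<close>, so the labelling condition holds.\<close>
  define I where "I = {\<beta> \<in> pos_roots n. \<exists>\<alpha>\<in>J. root_le \<alpha> \<beta>}"
  have J: "J \<subseteq> pos_roots n" by (auto simp: J_def non_inversions_def pos_roots_def)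
  have trans: "root_le \<alpha> \<gamma>" if "root_le \<alpha> \<beta>" "root_le \<beta> \<gamma>" for \<alpha> \<beta> \<gamma>
    using that by (simp add: root_le_def)
  have I: "root_ideal n I"
    unfolding root_ideal_def
  proof (intro conjI ballI impI)
    show "I \<subseteq> pos_roots n" by (auto simp: I_def)
    fix \<beta> \<gamma> assume "\<beta> \<in> I" "\<gamma> \<in> pos_roots n" "root_le \<beta> \<gamma>"
    then show "\<gamma> \<in> I" using trans unfolding I_def by fast
  qed
  have JI: "J \<subseteq> I" using J by (auto simp: I_def root_le_def)
  have "minimal_roots I \<subseteq> J"
  proof
    fix \<mu> assume \<mu>: "\<mu> \<in> minimal_roots I"
    then obtain \<alpha> where "\<alpha> \<in> J" "root_le \<alpha> \<mu>" by (auto simp: minimal_roots_def I_def)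
    then show "\<mu> \<in> J" using \<mu> JI by (auto simp: minimal_roots_def)
  qed
  then have lab: "(w, I) \<in> labeled_dyck_paths n"
    using w I by (auto simp: labeled_dyck_paths_def J_def)
  obtain x where x: "path_point n w I x" using path_point_exists[OF assms(1) w I] by blast
  then have sx: "sorts n w x" "generic n x" by (auto simp: path_point_def)
  have "same_shi_region n x z"
    unfolding same_shi_region_def
  proof clarify
    fix p q assume pq: "(p, q) \<in> pos_roots n"
    then have "p \<in> {1..n}" "q \<in> {1..n}" by (auto simp: pos_roots_def)
    then obtain i j where ij: "i \<in> {1..n}" "p = w i" "j \<in> {1..n}" "q = w j"
      using permutes_preimage[OF w] by meson
    have "p < q" using pq by (simp add: pos_roots_def)
    then have "i \<noteq> j" using ij by auto
    then consider "(i, j) \<in> pos_roots n" | "(j, i) \<in> pos_roots n"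
      using ij by (cases i j rule: linorder_cases) (auto simp: pos_roots_def)
    then show "(x p - x q < 0) = (z p - z q < 0) \<and> (x p - x q < 1) = (z p - z q < 1)"
    proof cases
      case 1
      \<comment> \<open>At a non-inversion the region also compares the difference with 1.\<close>
      have "0 < x (w i) - x (w j)" "0 < z (w i) - z (w j)"
        using comp_sorts(2)[OF sx 1] comp_sorts(2)[OF sz assms(2) 1] .
      moreover have "1 < x (w i) - x (w j) \<longleftrightarrow> 1 < z (w i) - z (w j)"
      proof -
        have "(i, j) \<in> J" if ijI: "(i, j) \<in> I"
        proof -
          obtain a b where ab: "(a, b) \<in> J" "root_le (a, b) (i, j)" using ijI by (auto simp: I_def)
          have "1 < z (w a) - z (w b)" using ab(1) by (simp add: J_def)
          also have "\<dots> \<le> z (w i) - z (w j)"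
            using sorts_diff_mono[OF sz 1 _ ab(2)] ab(1) J by blast
          finally show ?thesis
            using 1 \<open>p < q\<close> ij by (simp add: J_def non_inversions_def pos_roots_def)
        qed
        then have "(i, j) \<in> I \<longleftrightarrow> 1 < z (w i) - z (w j)"
          using JI 1 \<open>p < q\<close> ij by (auto simp: J_def non_inversions_def pos_roots_def)
        then show ?thesis using path_point_gt_one_iff[OF I x 1] by simp
      qed
      moreover have "x (w i) - x (w j) \<noteq> 1" "z (w i) - z (w j) \<noteq> 1"
        using comp_sorts(1)[OF sx 1] comp_sorts(1)[OF sz assms(2) 1] by auto
      ultimately show ?thesis unfolding ij by linarith
    next
      case 2
      \<comment> \<open>At an inversion both differences are negative, so level 1 gives no information.\<close>
      have "0 < x (w j) - x (w i)" "0 < z (w j) - z (w i)"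
        using comp_sorts(2)[OF sx 2] comp_sorts(2)[OF sz assms(2) 2] .
      then show ?thesis unfolding ij by linarith
    qed
  qed
  then show ?thesis using lab x by blast
qed

lemma shi_alcoves_iff:
  assumes "n \<ge> 1"
  shows "A \<in> shi_alcoves n \<longleftrightarrow>
    (\<exists>w I x. (w, I) \<in> labeled_dyck_paths n \<and> path_point n w I x \<and> A = alcove_of n x)"
proof
  assume "A \<in> shi_alcoves n"
  then obtain R where R: "R \<in> chambers n (Shi n)" "A \<in> alcoves n" "A \<subseteq> R"
    and min: "\<And>B. B \<in> alcoves n \<Longrightarrow> B \<subseteq> R \<Longrightarrow> \<not> alcove_length n B < alcove_length n A"
    by (auto simp: shi_alcoves_def is_arg_min_def)
  obtain z where z: "generic n z" "A = alcove_of n z" using R(2) by (auto simp: alcoves_eq)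
  obtain w I x where x: "(w, I) \<in> labeled_dyck_paths n" "path_point n w I x" "same_shi_region n x z"
    using path_point_in_Shi_region[OF assms z(1)] by blast
  have gx: "generic n x" using x(2) by (simp add: path_point_def)
  have "same_shi_region n z x" using x(3) unfolding same_shi_region_def split_beta by simp
  then have "alcove_of n x \<subseteq> R" using Shi_chamber_of_generic(2)[OF z(1) R(1) _ gx] R(3) z(2) by simp
  moreover have "alcove_of n x \<in> alcoves n" using gx by (simp add: alcoves_eq)
  ultimately have "\<not> alcove_length n (alcove_of n x) < alcove_length n A" using min by blast
  then have "A = alcove_of n x"
    unfolding z(2) using path_point_alcove_shortest(2)[OF assms x(1,2) z(1) x(3)] by simp
  then show "\<exists>w I x. (w, I) \<in> labeled_dyck_paths n \<and> path_point n w I x \<and> A = alcove_of n x"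
    using x by blast
next
  assume "\<exists>w I x. (w, I) \<in> labeled_dyck_paths n \<and> path_point n w I x \<and> A = alcove_of n x"
  then obtain w I x where x: "(w, I) \<in> labeled_dyck_paths n" "path_point n w I x"
    and A: "A = alcove_of n x" by blast
  have gx: "generic n x" using x(2) by (simp add: path_point_def)
  obtain R where R: "R \<in> chambers n (Shi n)"
    "\<And>y. generic n y \<Longrightarrow> alcove_of n y \<subseteq> R \<longleftrightarrow> same_shi_region n x y"
    using Shi_chamber_of_generic(1)[OF gx] by blast
  have "is_arg_min (alcove_length n) (\<lambda>B. B \<in> alcoves n \<and> B \<subseteq> R) A"
    unfolding is_arg_min_def
  proof (intro conjI notI)
    show "A \<in> alcoves n" using gx by (simp add: A alcoves_eq)
    show "A \<subseteq> R" using R(2)[OF gx] by (simp add: A same_shi_region_def)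
    assume "\<exists>B. (B \<in> alcoves n \<and> B \<subseteq> R) \<and> alcove_length n B < alcove_length n A"
    then obtain z where z: "generic n z" "alcove_of n z \<subseteq> R"
      "alcove_length n (alcove_of n z) < alcove_length n A"
      by (auto simp: alcoves_eq)
    then show False
      using path_point_alcove_shortest(1)[OF assms x z(1)] R(2)[OF z(1)] by (simp add: A)
  qed
  then show "A \<in> shi_alcoves n" using R(1) by (auto simp: shi_alcoves_def)
qed

section \<open>The bijection and its statistics\<close>

lemma alcove_to_path_alcove_of:
  assumes "(w, I) \<in> labeled_dyck_paths n" "path_point n w I x"
  shows "alcove_to_path n (alcove_of n x) = (w, I)"
proof -
  have I: "root_ideal n I" using assms(1) by (simp add: labeled_dyck_paths_def)
  have sx: "sorts n w x" "generic n x" using assms(2) by (auto simp: path_point_def)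
  have "I \<subseteq> pos_roots n" using I by (simp add: root_ideal_def)
  then have "alcove_ideal n (alcove_of n x) = I"
    unfolding alcove_ideal_alcove_of[OF sx] using path_point_gt_one_iff[OF I assms(2)] by auto
  then show ?thesis by (simp add: alcove_to_path_def alcove_perm_alcove_of[OF sx])
qed

lemma path_points_same_alcove:
  assumes "path_point n w I x" "path_point n w I z"
  shows "alcove_of n x = alcove_of n z"
  by (rule alcove_of_eqI[OF path_pointD(2,1)[OF assms(1)] path_pointD(2,1)[OF assms(2)]])
     (simp add: path_pointD(3)[OF assms(1)] path_pointD(3)[OF assms(2)])

lemma bij_betw_alcove_to_path:
  assumes "n \<ge> 1"
  shows "bij_betw (alcove_to_path n) (shi_alcoves n) (labeled_dyck_paths n)"
  unfolding bij_betw_def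
proof
  show "inj_on (alcove_to_path n) (shi_alcoves n)"
  proof (rule inj_onI)
    fix A B assume AB: "A \<in> shi_alcoves n" "B \<in> shi_alcoves n" "alcove_to_path n A = alcove_to_path n B"
    obtain w I x where x: "(w, I) \<in> labeled_dyck_paths n" "path_point n w I x" "A = alcove_of n x"
      using AB(1) shi_alcoves_iff[OF assms] by blast
    obtain v K z where z: "(v, K) \<in> labeled_dyck_paths n" "path_point n v K z" "B = alcove_of n z"
      using AB(2) shi_alcoves_iff[OF assms] by blast
    have "v = w \<and> K = I"
      using AB(3) alcove_to_path_alcove_of[OF x(1,2)] alcove_to_path_alcove_of[OF z(1,2)] x(3) z(3) by simp
    then show "A = B" using path_points_same_alcove[OF x(2)] z(2,3) x(3) by simp
  qed
  show "alcove_to_path n ` shi_alcoves n = labeled_dyck_paths n"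
  proof
    show "alcove_to_path n ` shi_alcoves n \<subseteq> labeled_dyck_paths n"
      using alcove_to_path_alcove_of by (auto simp: shi_alcoves_iff[OF assms])
    show "labeled_dyck_paths n \<subseteq> alcove_to_path n ` shi_alcoves n"
    proof
      fix p assume "p \<in> labeled_dyck_paths n"
      moreover obtain w I where p: "p = (w, I)" by (cases p)
      ultimately have lab: "(w, I) \<in> labeled_dyck_paths n" by simp
      then have "w permutes {1..n}" "root_ideal n I" by (auto simp: labeled_dyck_paths_def)
      then obtain x where x: "path_point n w I x" using path_point_exists[OF assms] by blast
      have "alcove_of n x \<in> shi_alcoves n" using x shi_alcoves_iff[OF assms] lab by blast
      then show "p \<in> alcove_to_path n ` shi_alcoves n"
        using alcove_to_path_alcove_of[OF lab x] p by (metis imageI)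
    qed
  qed
qed

lemma card_pos_roots: "card (pos_roots n) = n choose 2"
proof (induction n)
  case 0
  have "pos_roots 0 = {}" by (auto simp: pos_roots_def)
  then show ?case by simp
next
  case (Suc n)
  have "pos_roots (Suc n) = pos_roots n \<union> (\<lambda>i. (i, Suc n)) ` {1..n}"
    by (auto simp: pos_roots_def image_iff)
  moreover have "pos_roots n \<inter> (\<lambda>i. (i, Suc n)) ` {1..n} = {}" by (auto simp: pos_roots_def)
  moreover have "card ((\<lambda>i. (i, Suc n)) ` {1..n}) = n" by (subst card_image) (auto simp: inj_on_def)
  ultimately have "card (pos_roots (Suc n)) = card (pos_roots n) + n"
    by (simp add: card_Un_disjoint finite_pos_roots)
  then show ?case using Suc by (simp add: numeral_2_eq_2)
qed

text \<open>
  The \<open>shi\<close> statistic counts inversions together with the non-inversions in \<open>I\<close>; what remains of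
  the positive roots are the non-inversions below the path.
\<close>

lemma shi_plus_area':
  assumes "n \<ge> 1" "(w, I) \<in> labeled_dyck_paths n" "path_point n w I x"
  shows "shi n (alcove_of n x) + area' n w I = n choose 2"
proof -
  have w: "w permutes {1..n}" and I: "root_ideal n I"
    using assms(2) by (auto simp: labeled_dyck_paths_def)
  have sx: "sorts n w x" "generic n x" using assms(3) by (auto simp: path_point_def)
  define S where "S = {(i, j) \<in> pos_roots n. w j < w i \<or> 1 < x (w i) - x (w j)}"
  have "non_inversions n w - I = pos_roots n - S"
  proof (intro set_eqI)
    fix p :: "nat \<times> nat"
    obtain i j where p: "p = (i, j)" by (cases p)
    have "w i \<noteq> w j" if "(i, j) \<in> pos_roots n"
      using that permutes_inj[OF w] by (auto simp: pos_roots_def inj_eq)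
    then show "p \<in> non_inversions n w - I \<longleftrightarrow> p \<in> pos_roots n - S"
      using path_point_gt_one_iff[OF I assms(3), of i j]
      unfolding p S_def non_inversions_def pos_roots_def by auto
  qed
  moreover have S: "S \<subseteq> pos_roots n" by (auto simp: S_def)
  ultimately have "area' n w I = card (pos_roots n) - card S"
    unfolding area'_def
    by (simp only: card_Diff_subset[OF finite_subset[OF S finite_pos_roots] S])
  moreover have "shi n (alcove_of n x) = card S"
    unfolding S_def by (rule shi_sorted[OF assms(1) sx])
  moreover have "card S \<le> card (pos_roots n)"
    by (rule card_mono[OF finite_pos_roots S])
  ultimately show ?thesis by (simp add: card_pos_roots)
qed

lemma ish_eq_bounce:
  assumes "n \<ge> 1" "(w, I) \<in> labeled_dyck_paths n" "path_point n w I x"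
  shows "ish n (alcove_of n x) = bounce n I"
proof -
  have I: "root_ideal n I" using assms(2) by (simp add: labeled_dyck_paths_def)
  have sx: "sorts n w x" "generic n x" using assms(3) by (auto simp: path_point_def)
  have "ish n (alcove_of n x) = (\<Sum>i=1..n - 1. nat \<lfloor>x (w i) - x (w n)\<rfloor>)"
    by (rule ish_sorted[OF assms(1) sx])
  also have "\<dots> = (\<Sum>i=1..n - 1. bounce_count I i n)"
  proof (intro sum.cong refl)
    fix i assume "i \<in> {1..n - 1}"
    then have "(i, n) \<in> pos_roots n" by (auto simp: pos_roots_def)
    then have "\<lfloor>x (w i) - x (w n)\<rfloor> = int (bounce_count I i n)"
      using assms(3) unfolding path_point_def by blast
    then show "nat \<lfloor>x (w i) - x (w n)\<rfloor> = bounce_count I i n" by simp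
  qed
  also have "\<dots> = bounce n I" by (rule sum_bounce_count[OF I])
  finally show ?thesis .
qed

theorem theorem6:
  fixes n :: nat
  assumes "n \<ge> 1"
  shows "bij_betw (alcove_to_path n) (shi_alcoves n) (labeled_dyck_paths n) \<and>
    (\<forall>A\<in>shi_alcoves n. \<forall>w I. alcove_to_path n A = (w, I) \<longrightarrow>
       int (n choose 2) - int (shi n A) = int (area' n w I) \<and>
       ish n A = bounce n I)"
proof (intro conjI ballI allI impI)
  show "bij_betw (alcove_to_path n) (shi_alcoves n) (labeled_dyck_paths n)"
    by (rule bij_betw_alcove_to_path[OF assms])
  fix A w I assume A: "A \<in> shi_alcoves n" "alcove_to_path n A = (w, I)"
  then obtain v K x where x: "(v, K) \<in> labeled_dyck_paths n" "path_point n v K x"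
    and Ax: "A = alcove_of n x"
    using shi_alcoves_iff[OF assms] by blast
  then have vK: "v = w" "K = I" using A(2) alcove_to_path_alcove_of[OF x] by simp_all
  show "int (n choose 2) - int (shi n A) = int (area' n w I)"
    using shi_plus_area'[OF assms x] unfolding Ax vK by linarith
  show "ish n A = bounce n I" using ish_eq_bounce[OF assms x] by (simp add: Ax vK)
qed

end
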